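(* Let $a,b>0$ be endpoint weights and assume $J=\int_\Omega\Delta^2p\,d\mu>0$. Then, as $\varepsilon\to0$, the local balancing root satisfies \[ t_\varepsilon=t_0+\varepsilon\,\tau(a,b;u_A,u_B)+o(\varepsilon),\qquad \tau(a,b;u_A,u_B)=\frac{A_3L_3\{a t_0^3+b(1-t_0)^3\}}{2A_2J\{a t_0+b(1-t_0)\}}. \] The fused segment density has the expansion \[ (1-t_\varepsilon)r^\varepsilon+t_\varepsilon s^\varepsilon=p+\varepsilon H_{AB}+\varepsilon^2B_{AB}+o(\varepsilon^2) \] with remainder measured in $\|\cdot\|_{p,\infty}$, where \[ H_{AB}=(1-t_0)h_A+t_0h_B,\qquad B_{AB}=(1-t_0)B_A+t_0B_B+\tau(a,b;u_A,u_B)(h_B-h_A). \]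
   Context: $(\Omega,\mathcal F,\mu)$ is a measure space and $p$ is a strictly positive probability density with respect to $\mu$. For measurable $q$ with $q/p\in L^\infty(\mu)$, put $\|q\|_{p,\infty}=\|q/p\|_\infty$. The real parameter $\varepsilon\neq0$ tends to $0$; $o(\varepsilon^k)$ means that the remainder divided by $|\varepsilon|^k$ tends to zero in the relevant norm. The endpoints are probability densities \[ r^\varepsilon=p+\varepsilon h_A+\varepsilon^2B_A+o(\varepsilon^2),\qquad s^\varepsilon=p+\varepsilon h_B+\varepsilon^2B_B+o(\varepsilon^2), \] with remainders measured in $\|\cdot\|_{p,\infty}$, where $\int h_A\,d\mu=\int h_B\,d\mu=\int B_A\,d\mu=\int B_B\,d\mu=0$ and $h_A/p,\,h_B/p,\,B_A/p,\,B_B/p$ are bounded. Put \[ u_A=h_A/p,\quad u_B=h_B/p,\quad\Delta=u_B-u_A,\quad J=\int_\Omega\Delta^2p\,d\mu,\quad L_3=\int_\Omega\Delta^3p\,d\mu. \] $f:(0,\infty)\to\mathbb R$ is convex and $C^3$ in a neighborhood of $1$, with $f(1)=0$, $f'(1)=0$, $f''(1)>0$; $A_2=f''(1)/2$, $A_3=f'''(1)/6$; and $D_f(r\|q)=\int_\Omega q\,f(r/q)\,d\mu$. The balancing equation for $t\in[0,1]$ is \[ a\,D_f(r^\varepsilon\|(1-t)r^\varepsilon+ts^\varepsilon)=b\,D_f(s^\varepsilon\|(1-t)r^\varepsilon+ts^\varepsilon). \] Put $t_0=\frac{\sqrt b}{\sqrt a+\sqrt b}$. The local balancing root $t_\varepsilon$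 is the solution branch converging to $t_0$ as $\varepsilon\to0$: for all sufficiently small $\varepsilon\ne0$ it is the unique solution in a fixed sufficiently small neighborhood of $t_0$. *)

theory Defs
  imports "HOL-Probability.Essential_Supremum" "HOL-Library.Landau_Symbols"
begin

definition prob_density :: "'a measure \<Rightarrow> ('a \<Rightarrow> real) \<Rightarrow> bool" where
  "prob_density M q \<longleftrightarrow>
     integrable M q \<and> (\<forall>x\<in>space M. 0 \<le> q x) \<and> (LINT x|M. q x) = 1"

definition rel_bounded :: "'a measure \<Rightarrow> ('a \<Rightarrow> real) \<Rightarrow> ('a \<Rightarrow> real) \<Rightarrow> bool" where
  "rel_bounded M p q \<longleftrightarrow>
     q \<in> borel_measurable M \<and> esssup M (\<lambda>x. ereal \<bar>q x / p x\<bar>) < \<infinity>"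

(* Only meaningful when rel_bounded M p q holds, because real_of_ereal sends infinity to 0. *)
definition rel_norm :: "'a measure \<Rightarrow> ('a \<Rightarrow> real) \<Rightarrow> ('a \<Rightarrow> real) \<Rightarrow> real" where
  "rel_norm M p q = real_of_ereal (esssup M (\<lambda>x. ereal \<bar>q x / p x\<bar>))"

definition rel_smallo ::
  "'a measure \<Rightarrow> ('a \<Rightarrow> real) \<Rightarrow> nat \<Rightarrow> (real \<Rightarrow> 'a \<Rightarrow> real) \<Rightarrow> bool" where
  "rel_smallo M p k R \<longleftrightarrow>
     (\<forall>\<^sub>F \<epsilon> in at 0. rel_bounded M p (R \<epsilon>)) \<and>
     (\<lambda>\<epsilon>. rel_norm M p (R \<epsilon>)) \<in> o[at 0](\<lambda>\<epsilon>. \<epsilon> ^ k)"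

definition second_order_expansion ::
  "'a measure \<Rightarrow> ('a \<Rightarrow> real) \<Rightarrow> (real \<Rightarrow> 'a \<Rightarrow> real) \<Rightarrow> ('a \<Rightarrow> real) \<Rightarrow> ('a \<Rightarrow> real) \<Rightarrow> bool" where
  "second_order_expansion M p r h B \<longleftrightarrow>
     rel_smallo M p 2 (\<lambda>\<epsilon> x. r \<epsilon> x - (p x + \<epsilon> * h x + \<epsilon>\<^sup>2 * B x))"

definition Ck_on :: "nat \<Rightarrow> (real \<Rightarrow> real) \<Rightarrow> real set \<Rightarrow> bool" where
  "Ck_on k f U \<longleftrightarrow>
     (\<forall>j<k. \<forall>x\<in>U. (deriv ^^ j) f differentiable at x) \<and> continuous_on U ((deriv ^^ k) f)"

(* f is a function on the positive reals; its values elsewhere are irrelevant up to null sets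
   whenever both densities are almost everywhere positive. *)
definition f_div ::
  "'a measure \<Rightarrow> (real \<Rightarrow> real) \<Rightarrow> ('a \<Rightarrow> real) \<Rightarrow> ('a \<Rightarrow> real) \<Rightarrow> real" where
  "f_div M f r q = (LINT x|M. q x * f (r x / q x))"

definition segment :: "real \<Rightarrow> ('a \<Rightarrow> real) \<Rightarrow> ('a \<Rightarrow> real) \<Rightarrow> 'a \<Rightarrow> real" where
  "segment t r s = (\<lambda>x. (1 - t) * r x + t * s x)"

definition balancing ::
  "'a measure \<Rightarrow> (real \<Rightarrow> real) \<Rightarrow> real \<Rightarrow> real \<Rightarrow> ('a \<Rightarrow> real) \<Rightarrow> ('a \<Rightarrow> real) \<Rightarrow> real \<Rightarrow> bool" where
  "balancing M f a b r s t \<longleftrightarrow>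
     a * f_div M f r (segment t r s) = b * f_div M f s (segment t r s)"

definition t_zero :: "real \<Rightarrow> real \<Rightarrow> real" where
  "t_zero a b = sqrt b / (sqrt a + sqrt b)"

definition local_balancing_root ::
  "'a measure \<Rightarrow> (real \<Rightarrow> real) \<Rightarrow> real \<Rightarrow> real \<Rightarrow>
   (real \<Rightarrow> 'a \<Rightarrow> real) \<Rightarrow> (real \<Rightarrow> 'a \<Rightarrow> real) \<Rightarrow> (real \<Rightarrow> real) \<Rightarrow> bool" where
  "local_balancing_root M f a b r s T \<longleftrightarrow>
     (T \<longlongrightarrow> t_zero a b) (at 0) \<and>
     (\<exists>\<delta>>0. \<forall>\<^sub>F \<epsilon> in at 0.
        {t \<in> {0..1}. \<bar>t - t_zero a b\<bar> < \<delta> \<and> balancing M f a b (r \<epsilon>) (s \<epsilon>) t} = {T \<epsilon>})"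

definition J_const :: "'a measure \<Rightarrow> ('a \<Rightarrow> real) \<Rightarrow> ('a \<Rightarrow> real) \<Rightarrow> ('a \<Rightarrow> real) \<Rightarrow> real" where
  "J_const M p uA uB = (LINT x|M. (uB x - uA x) ^ 2 * p x)"

definition L3_const :: "'a measure \<Rightarrow> ('a \<Rightarrow> real) \<Rightarrow> ('a \<Rightarrow> real) \<Rightarrow> ('a \<Rightarrow> real) \<Rightarrow> real" where
  "L3_const M p uA uB = (LINT x|M. (uB x - uA x) ^ 3 * p x)"

definition A2_const :: "(real \<Rightarrow> real) \<Rightarrow> real" where
  "A2_const f = (deriv ^^ 2) f 1 / 2"

definition A3_const :: "(real \<Rightarrow> real) \<Rightarrow> real" where
  "A3_const f = (deriv ^^ 3) f 1 / 6"

definition root_slope ::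
  "'a measure \<Rightarrow> ('a \<Rightarrow> real) \<Rightarrow> (real \<Rightarrow> real) \<Rightarrow> real \<Rightarrow> real \<Rightarrow> ('a \<Rightarrow> real) \<Rightarrow> ('a \<Rightarrow> real) \<Rightarrow> real" where
  "root_slope M p f a b uA uB =
     A3_const f * L3_const M p uA uB * (a * t_zero a b ^ 3 + b * (1 - t_zero a b) ^ 3) /
     (2 * A2_const f * J_const M p uA uB * (a * t_zero a b + b * (1 - t_zero a b)))"

end

theory Submission
  imports Defs
begin

text \<open>Dividing everything by \<open>p\<close>, the integrand of \<open>D\<^sub>f\<close> is \<open>q f(v/q)\<close> with \<open>v = r/p\<close> and \<open>q = v + t (w - v)\<close>, \<open>w = s/p\<close>.
  Since \<open>v/q - 1 = O(\<epsilon>)\<close>, a cubic Taylor expansion of \<open>f\<close> at \<open>1\<close> gives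
  \<open>D\<^sub>f = \<epsilon>\<^sup>2 A\<^sub>2 t\<^sup>2 J + \<epsilon>\<^sup>3 (\<dots>) + o(\<epsilon>\<^sup>3)\<close> uniformly in \<open>t \<in> [0, 1]\<close>, and the expansion for \<open>s\<close> follows by
  exchanging the endpoints and replacing \<open>t\<close> by \<open>1 - t\<close>. So the leading order of the balance is
  \<open>A\<^sub>2 J (a t\<^sup>2 - b (1 - t)\<^sup>2) = A\<^sub>2 J (\<surd>a + \<surd>b) (\<surd>a t + \<surd>b (1 - t)) (t - t\<^sub>0)\<close>; dividing the balancing equation by \<open>\<epsilon>\<^sup>3\<close>
  yields the limit of \<open>(t\<^sub>\<epsilon> - t\<^sub>0)/\<epsilon>\<close>. Existence and uniqueness of the root need no differentiation in \<open>t\<close>: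
  \<open>t \<mapsto> D\<^sub>f(r \<parallel> (1 - t) r + t s)\<close> is convex (a perspective of \<open>f\<close>) and vanishes at \<open>0\<close>, hence it is continuous on
  \<open>(0, 1)\<close> and strictly increasing from any point where it is positive.\<close>

section \<open>Pointwise expansion of the divergence integrand\<close>

text \<open>The Lagrange remainder is the third derivative at an intermediate point, and continuity
  at 1 brings it close to the value at 1. The filter is \<open>nhds 0\<close> and not
  \<open>at 0\<close> because the increment inserted later may vanish, for instance at t =
  0.\<close>

lemma cubic_taylor_remainder:
  assumes "open U" "1 \<in> U" "Ck_on 3 f U" and f1: "f 1 = 0" "deriv f 1 = 0"
  shows "(\<lambda>y. f (1 + y) - (A2_const f * y^2 + A3_const f * y^3)) \<in> o[nhds 0](\<lambda>y. y^3)"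
proof (rule landau_o.smallI)
  fix c :: real assume c: "c > 0"
  have diffable: "(deriv ^^ j) f differentiable at x" if "j < 3" "x \<in> U" for j x
    using assms that by (auto simp: Ck_on_def)
  have der: "((deriv ^^ j) f has_real_derivative (deriv ^^ Suc j) f x) (at x)" if "j < 3" "x \<in> U" for j x
    using diffable[OF that] by (simp flip: DERIV_deriv_iff_real_differentiable)
  have "isCont ((deriv ^^ 3) f) 1"
    using assms by (auto simp: Ck_on_def continuous_on_eq_continuous_at)
  then have "\<forall>\<^sub>F x in nhds 1. dist ((deriv ^^ 3) f x) ((deriv ^^ 3) f 1) < c"
    using c unfolding isCont_def tendsto_iff eventually_at_filter
    by (auto elim!: eventually_mono)
  moreover have "\<forall>\<^sub>F x in nhds 1. x \<in> U"
    using assms by (simp add: eventually_nhds_in_open)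
  ultimately have "\<forall>\<^sub>F x in nhds 1. x \<in> U \<and> dist ((deriv ^^ 3) f x) ((deriv ^^ 3) f 1) < c"
    by eventually_elim auto
  then obtain d where d: "d > 0" "\<And>x. dist x 1 < d \<Longrightarrow> x \<in> U \<and> dist ((deriv ^^ 3) f x) ((deriv ^^ 3) f 1) < c"
    unfolding eventually_nhds_metric by auto
  have "norm (f (1 + y) - (A2_const f * y^2 + A3_const f * y^3)) \<le> c * norm (y^3)" if y: "dist y 0 < d" for y
  proof (cases "y = 0")
    case True
    then show ?thesis using f1 by simp
  next
    case False
    have "\<exists>t. (if 1 + y < 1 then 1 + y < t \<and> t < 1 else 1 < t \<and> t < 1 + y) \<and>
        f (1 + y) = (\<Sum>m<3. ((deriv ^^ m) f 1 / fact m) * (1 + y - 1)^m)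
          + ((deriv ^^ 3) f t / fact 3) * (1 + y - 1)^3"
    \<comment> \<open>A symmetric interval around 1 treats both signs of \<open>y\<close> at
      once.\<close>
    proof (rule Taylor[where a = "1 - \<bar>y\<bar>" and b = "1 + \<bar>y\<bar>"])
      show "\<forall>m t. m < 3 \<and> 1 - \<bar>y\<bar> \<le> t \<and> t \<le> 1 + \<bar>y\<bar> \<longrightarrow>
          ((deriv ^^ m) f has_real_derivative (deriv ^^ Suc m) f t) (at t)"
        using y by (intro allI impI der) (auto intro!: d(2)[THEN conjunct1] simp: dist_real_def)
    qed (use False in auto)
    then obtain t where t: "\<bar>t - 1\<bar> \<le> \<bar>y\<bar>" and eq: "f (1 + y) = (\<Sum>m<3. ((deriv ^^ m) f 1 / fact m) * y^m)
          + ((deriv ^^ 3) f t / fact 3) * y^3"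
      by (cases "y < 0") force+
    have "f (1 + y) - (A2_const f * y^2 + A3_const f * y^3) = ((deriv ^^ 3) f t - (deriv ^^ 3) f 1) / 6 * y^3"
      unfolding eq using f1
      by (simp add: eval_nat_numeral A2_const_def A3_const_def field_simps)
    also have "norm \<dots> \<le> c / 6 * norm (y^3)"
      unfolding norm_mult using d(2)[of t] t y
      by (intro mult_right_mono) (auto simp: dist_real_def)
    also have "\<dots> \<le> c * norm (y^3)" using c by (intro mult_right_mono) auto
    finally show ?thesis .
  qed
  then show "\<forall>\<^sub>F y in nhds 0. norm (f (1 + y) - (A2_const f * y^2 + A3_const f * y^3)) \<le> c * norm (y^3)"
    using d(1) unfolding eventually_nhds_metric by blast
qed

text \<open>Bounded functions form an algebra and null functions an ideal in it. As introduction
  rules these decide boundedness by the shape of a term; \<open>smallo_1_mult\<close> wants the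
  small factor first, and later error terms are written accordingly.\<close>

lemma bigo_1_add: "f \<in> O[F](\<lambda>_. 1) \<Longrightarrow> g \<in> O[F](\<lambda>_. 1) \<Longrightarrow> (\<lambda>x. f x + g x :: real) \<in> O[F](\<lambda>_. 1)"
  and bigo_1_diff: "f \<in> O[F](\<lambda>_. 1) \<Longrightarrow> g \<in> O[F](\<lambda>_. 1) \<Longrightarrow> (\<lambda>x. f x - g x :: real) \<in> O[F](\<lambda>_. 1)"
  and bigo_1_mult: "f \<in> O[F](\<lambda>_. 1) \<Longrightarrow> g \<in> O[F](\<lambda>_. 1) \<Longrightarrow> (\<lambda>x. f x * g x :: real) \<in> O[F](\<lambda>_. 1)"
  and bigo_1_power: "f \<in> O[F](\<lambda>_. 1) \<Longrightarrow> (\<lambda>x. f x ^ n :: real) \<in> O[F](\<lambda>_. 1)"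
  and smallo_1_add: "f \<in> o[F](\<lambda>_. 1) \<Longrightarrow> g \<in> o[F](\<lambda>_. 1) \<Longrightarrow> (\<lambda>x. f x + g x :: real) \<in> o[F](\<lambda>_. 1)"
  and smallo_1_diff: "f \<in> o[F](\<lambda>_. 1) \<Longrightarrow> g \<in> o[F](\<lambda>_. 1) \<Longrightarrow> (\<lambda>x. f x - g x :: real) \<in> o[F](\<lambda>_. 1)"
  and smallo_1_mult: "f \<in> o[F](\<lambda>_. 1) \<Longrightarrow> g \<in> O[F](\<lambda>_. 1) \<Longrightarrow> (\<lambda>x. f x * g x :: real) \<in> o[F](\<lambda>_. 1)"
  using landau_o.small_big_mult[of f F "\<lambda>_. 1" g "\<lambda>_. 1"]
    landau_o.big_power[of f F "\<lambda>_. 1" n]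
  by (auto intro: sum_in_bigo sum_in_smallo landau_o.big.mult_in_1)

lemmas landau_1_intros =
  bigo_1_add bigo_1_diff bigo_1_mult bigo_1_power smallo_1_add smallo_1_diff smallo_1_mult bigo_const

text \<open>With \<open>v / q = 1 + y\<close> and \<open>y\<close> of order \<open>E\<close>, the
  cubic polynomial of \<open>f\<close> is inserted, and \<open>y^2\<close> and \<open>y^3\<close>
  are expanded in \<open>E\<close>. The filter is arbitrary, so that \<open>E\<close>, the parameter
  \<open>t\<close> and the sample point can all vary along it and uniformity comes for free.\<close>

lemma scaled_divergence_expansion:
  fixes E t u u' \<beta> \<beta>' v w :: "'c \<Rightarrow> real"
  defines "q \<equiv> \<lambda>x. v x + t x * (w x - v x)" and "\<Delta> \<equiv> \<lambda>x. u' x - u x" and "\<Delta>2 \<equiv> \<lambda>x. \<beta>' x - \<beta> x"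
  assumes taylor: "(\<lambda>y. f (1 + y) - (A2 * y^2 + A3 * y^3)) \<in> o[nhds 0](\<lambda>y. y^3)"
    and E: "filterlim E (at 0) F"
    and bdd: "t \<in> O[F](\<lambda>_. 1)" "u \<in> O[F](\<lambda>_. 1)" "u' \<in> O[F](\<lambda>_. 1)" "\<beta> \<in> O[F](\<lambda>_. 1)" "\<beta>' \<in> O[F](\<lambda>_. 1)"
    and v: "(\<lambda>x. v x - (1 + E x * u x + (E x)^2 * \<beta> x)) \<in> o[F](\<lambda>x. E x ^ 2)"
    and w: "(\<lambda>x. w x - (1 + E x * u' x + (E x)^2 * \<beta>' x)) \<in> o[F](\<lambda>x. E x ^ 2)"
  shows "(\<lambda>x. q x * f (v x / q x) - (E x ^ 2 * (A2 * (t x)^2 * (\<Delta> x)^2)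
      + E x ^ 3 * (A2 * (t x)^2 * (2 * \<Delta> x * \<Delta>2 x - (\<Delta> x)^2 * u x) - (A2 + A3) * (t x)^3 * (\<Delta> x)^3)))
    \<in> o[F](\<lambda>x. E x ^ 3)"
proof -
  have E0: "\<forall>\<^sub>F x in F. E x \<noteq> 0" and Elim: "(E \<longlongrightarrow> 0) F"
    using E by (auto simp: filterlim_at)
  have Eo: "E \<in> o[F](\<lambda>_. 1)"
    using Elim by (intro smalloI_tendsto) auto
  note EO = landau_o.small_imp_big[OF Eo]
  \<comment> \<open>The remainders of \<open>v\<close> and \<open>w\<close> in units of
    \<open>E^2\<close>; they tend to zero.\<close>
  define \<sigma> where "\<sigma> = (\<lambda>x. (v x - (1 + E x * u x + (E x)^2 * \<beta> x)) / E x ^ 2)"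
  define \<sigma>' where "\<sigma>' = (\<lambda>x. (w x - (1 + E x * u' x + (E x)^2 * \<beta>' x)) / E x ^ 2)"
  have \<sigma>: "\<sigma> \<in> o[F](\<lambda>_. 1)" unfolding \<sigma>_def
    using v E0 by (subst landau_o.small.divide_eq2) (auto elim!: eventually_mono)
  have \<sigma>': "\<sigma>' \<in> o[F](\<lambda>_. 1)" unfolding \<sigma>'_def
    using w E0 by (subst landau_o.small.divide_eq2) (auto elim!: eventually_mono)
  note \<sigma>O = \<sigma>[THEN landau_o.small_imp_big] \<sigma>'[THEN landau_o.small_imp_big]
  have DO: "\<Delta> \<in> O[F](\<lambda>_. 1)" "\<Delta>2 \<in> O[F](\<lambda>_. 1)"
    unfolding \<Delta>_def \<Delta>2_def by (intro landau_1_intros bdd)+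
  \<comment> \<open>Chosen so that \<open>q = 1 + E * \<kappa>\<close> and
    \<open>w - v = E * \<delta>\<close> hold exactly; \<open>\<nu>\<close> is the second-order part
    of \<open>q\<close>, with the remainders included.\<close>
  define \<eta> where "\<eta> = (\<lambda>x. \<sigma>' x - \<sigma> x)"
  define \<nu> where "\<nu> = (\<lambda>x. \<beta> x + \<sigma> x + t x * (\<Delta>2 x + \<eta> x))"
  define \<kappa> where "\<kappa> = (\<lambda>x. u x + t x * \<Delta> x + E x * \<nu> x)"
  define \<delta> where "\<delta> = (\<lambda>x. \<Delta> x + E x * (\<Delta>2 x + \<eta> x))"
  have \<eta>: "\<eta> \<in> o[F](\<lambda>_. 1)" unfolding \<eta>_def using \<sigma> \<sigma>' by (intro landau_1_intros)
  note \<eta>O = \<eta>[THEN landau_o.small_imp_big]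
  have lO: "\<nu> \<in> O[F](\<lambda>_. 1)" unfolding \<nu>_def using bdd \<sigma>O \<eta>O DO by (intro landau_1_intros)
  have kO: "\<kappa> \<in> O[F](\<lambda>_. 1)" unfolding \<kappa>_def using bdd EO DO lO by (intro landau_1_intros)
  have dO: "\<delta> \<in> O[F](\<lambda>_. 1)" unfolding \<delta>_def using \<eta>O EO DO by (intro landau_1_intros)
  have Ek: "(\<lambda>x. E x * \<kappa> x) \<in> o[F](\<lambda>_. 1)" using Eo kO by (intro landau_1_intros)
  have Ek0: "((\<lambda>x. 1 + E x * \<kappa> x) \<longlongrightarrow> 1) F"
    using tendsto_add[OF tendsto_const[of 1] smalloD_tendsto[OF Ek]] by simp
  have q_pos: "\<forall>\<^sub>F x in F. 1 + E x * \<kappa> x > 0"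
    using order_tendstoD(1)[OF Ek0, of 0] by simp
  define i where "i = (\<lambda>x. inverse (1 + E x * \<kappa> x))"
  have "(i \<longlongrightarrow> inverse 1) F" unfolding i_def using Ek0 by (intro tendsto_inverse) auto
  then have iO: "i \<in> O[F](\<lambda>_. 1)" by (intro bigoI_tendsto[where c = "inverse 1"]) auto
  \<comment> \<open>This is \<open>v / q - 1 = - t * (w - v) / q\<close>, with \<open>i\<close>
    standing for \<open>1 / q\<close>.\<close>
  define y where "y = (\<lambda>x. E x * (- t x * \<delta> x * i x))"
  have yO: "y \<in> O[F](E)" and yo: "y \<in> o[F](\<lambda>_. 1)"
  proof -
    have *: "(\<lambda>x. - t x * \<delta> x * i x) \<in> O[F](\<lambda>_. 1)"
      using bdd dO iO by (intro landau_1_intros) auto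
    show "y \<in> O[F](E)" unfolding y_def using landau_o.big.mult[OF landau_o.big_refl *, of E] by simp
    show "y \<in> o[F](\<lambda>_. 1)" unfolding y_def by (rule smallo_1_mult[OF Eo *])
  qed
  have R: "(\<lambda>x. f (1 + y x) - (A2 * y x^2 + A3 * y x^3)) \<in> o[F](\<lambda>x. E x ^ 3)"
  proof -
    have "filterlim y (nhds 0) F" using smalloD_tendsto[OF yo] by simp
    from landau_o.small.compose[OF taylor this]
    have "(\<lambda>x. f (1 + y x) - (A2 * y x^2 + A3 * y x^3)) \<in> o[F](\<lambda>x. y x ^ 3)" .
    then show ?thesis using landau_o.big_power[OF yO, of 3] by (rule landau_o.small_big_trans)
  qed
  have R': "(\<lambda>x. (1 + E x * \<kappa> x) * (f (1 + y x) - (A2 * y x^2 + A3 * y x^3))) \<in> o[F](\<lambda>x. E x ^ 3)"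
    using landau_o.big_small_mult[OF _ R, of "\<lambda>x. 1 + E x * \<kappa> x" "\<lambda>_. 1"] EO kO
    by (simp add: landau_1_intros)
  \<comment> \<open>The exact errors of expanding \<open>\<delta>^2 / q\<close> to first order (in
    units of \<open>E\<close>) and \<open>\<delta>^3 / q^2\<close> to order zero. Writing them out
    as polynomials in \<open>i\<close> and bounded functions lets the Landau rules show that both
    vanish in the limit.\<close>
  define b1 where "b1 = (\<lambda>x. \<eta> x * (2 * \<Delta> x * i x) + E x * ((\<Delta>2 x + \<eta> x)^2 * i x - (\<Delta> x)^2 * \<nu> x
       + (\<Delta> x)^2 * (\<kappa> x)^2 * i x - 2 * \<Delta> x * \<Delta>2 x * \<kappa> x * i x))"
  define b2 where "b2 = (\<lambda>x. E x * ((3 * (\<Delta> x)^2 * (\<Delta>2 x + \<eta> x) + 3 * E x * \<Delta> x * (\<Delta>2 x + \<eta> x)^2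
       + (E x)^2 * (\<Delta>2 x + \<eta> x)^3) * (i x)^2 - (\<Delta> x)^3 * \<kappa> x * (2 + E x * \<kappa> x) * (i x)^2))"
  have b: "(\<lambda>x. b1 x * (A2 * (t x)^2) - b2 x * (A3 * (t x)^3)) \<in> o[F](\<lambda>_. 1)"
    unfolding b1_def b2_def using Eo EO \<eta> \<eta>O DO lO kO iO bdd
    by (intro landau_1_intros)
  have b': "(\<lambda>x. E x ^ 3 * (b1 x * (A2 * (t x)^2) - b2 x * (A3 * (t x)^3))) \<in> o[F](\<lambda>x. E x ^ 3)"
    using landau_o.big_small_mult[OF landau_o.big_refl b] by simp
  have "\<forall>\<^sub>F x in F. (1 + E x * \<kappa> x) * (f (1 + y x) - (A2 * y x^2 + A3 * y x^3))
      + E x ^ 3 * (b1 x * (A2 * (t x)^2) - b2 x * (A3 * (t x)^3))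
    = q x * f (v x / q x) - (E x ^ 2 * (A2 * (t x)^2 * (\<Delta> x)^2)
      + E x ^ 3 * (A2 * (t x)^2 * (2 * \<Delta> x * \<Delta>2 x - (\<Delta> x)^2 * u x) - (A2 + A3) * (t x)^3 * (\<Delta> x)^3))"
    using E0 q_pos
  proof eventually_elim
    case (elim x)
    define Q where "Q = 1 + E x * \<kappa> x"
    have Q: "Q > 0" "i x = 1 / Q" "E x * \<kappa> x = Q - 1" using elim by (auto simp: Q_def i_def inverse_eq_divide)
    have vx: "v x = 1 + E x * u x + (E x)^2 * (\<beta> x + \<sigma> x)"
      and wx: "w x = 1 + E x * u' x + (E x)^2 * (\<beta>' x + \<sigma>' x)"
      using elim by (simp_all add: \<sigma>_def \<sigma>'_def field_simps)
    have dx: "w x - v x = E x * \<delta> x"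
      unfolding vx wx \<delta>_def \<Delta>_def \<Delta>2_def \<eta>_def by (simp add: algebra_simps power2_eq_square)
    have qx: "q x = Q"
      unfolding q_def dx unfolding Q_def vx \<delta>_def \<kappa>_def \<nu>_def by (simp add: algebra_simps power2_eq_square)
    have vq: "v x / q x = 1 + y x"
    proof -
      have "v x = Q - t x * (E x * \<delta> x)" using qx dx by (simp add: q_def)
      then show ?thesis unfolding qx y_def Q(2) using Q(1) by (simp add: field_simps)
    qed
    have y2: "Q * y x ^ 2 = E x ^ 2 * (t x)^2 * ((\<delta> x)^2 / Q)"
      and y3: "Q * y x ^ 3 = - (E x ^ 3 * (t x)^3 * ((\<delta> x)^3 / Q^2))"
      unfolding y_def Q(2) using Q(1) by (simp_all add: field_simps power2_eq_square power3_eq_cube)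
    \<comment> \<open>The summand \<open>t x * \<Delta> x\<close>, from the first-order part of
      \<open>q\<close>, produces a further cubic term in \<open>t\<close> and turns the coefficient
      \<open>A3\<close> into \<open>A2 + A3\<close>.\<close>
    have D2: "(\<delta> x)^2 / Q = (\<Delta> x)^2 + E x * (2 * \<Delta> x * \<Delta>2 x - (\<Delta> x)^2 * (u x + t x * \<Delta> x)) + E x * b1 x"
    proof -
      \<comment> \<open>With \<open>i x\<close> as an unknown subject to \<open>i x * Q = 1\<close>,
        the claim becomes a polynomial identity.\<close>
      have "(i x) * Q = 1" using Q by simp
      then have "b1 x * Q = \<eta> x * (2 * \<Delta> x) + E x * ((\<Delta>2 x + \<eta> x)^2 - Q * ((\<Delta> x)^2 * \<nu> x)
          + (\<Delta> x)^2 * (\<kappa> x)^2 - 2 * \<Delta> x * \<Delta>2 x * \<kappa> x)"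
        unfolding b1_def by algebra
      moreover have "u x + t x * \<Delta> x = \<kappa> x - E x * \<nu> x" by (simp add: \<kappa>_def)
      ultimately have "(\<delta> x)^2 = ((\<Delta> x)^2 + E x * (2 * \<Delta> x * \<Delta>2 x - (\<Delta> x)^2 * (u x + t x * \<Delta> x)) + E x * b1 x) * Q"
        unfolding \<delta>_def Q_def by algebra
      then show ?thesis using Q by (simp add: divide_eq_eq)
    qed
    have D3: "(\<delta> x)^3 / Q^2 = (\<Delta> x)^3 + b2 x"
    proof -
      have "(i x) * Q = 1" using Q by simp
      then have "b2 x * Q^2 = E x * (3 * (\<Delta> x)^2 * (\<Delta>2 x + \<eta> x) + 3 * E x * \<Delta> x * (\<Delta>2 x + \<eta> x)^2
       + (E x)^2 * (\<Delta>2 x + \<eta> x)^3 - (\<Delta> x)^3 * \<kappa> x * (2 + E x * \<kappa> x))"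
        unfolding b2_def by algebra
      then have "(\<delta> x)^3 = ((\<Delta> x)^3 + b2 x) * Q^2"
        unfolding \<delta>_def Q_def by algebra
      then show ?thesis using Q by (simp add: divide_eq_eq)
    qed
    have "Q * (f (1 + y x) - (A2 * y x^2 + A3 * y x^3)) = Q * f (1 + y x) - A2 * (Q * y x ^ 2) - A3 * (Q * y x ^ 3)"
      by (simp add: algebra_simps)
    then show ?case unfolding vq unfolding qx Q_def[symmetric] y2 y3 D2 D3
      by (simp add: algebra_simps power2_eq_square power3_eq_cube)
  qed
  then show ?thesis
    using sum_in_smallo(1)[OF R' b'] by (subst (asm) landau_o.small.in_cong)
qed

section \<open>Remainders measured in the relative supremum norm\<close>

text \<open>The filter of the \<open>o\<close>-terms of the paper: \<open>\<epsilon> \<rightarrow> 0\<close>, uniformly in \<open>t \<in> [0, 1]\<close> and in almost every \<open>x\<close>.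
  Landau symbols along it express remainders measured in \<open>L\<^sup>\<infinity>\<close>.\<close>
definition aefilter :: "'a measure \<Rightarrow> (real \<times> real \<times> 'a) filter" where
  "aefilter M = Abs_filter (\<lambda>P. \<forall>\<^sub>F \<epsilon> in at 0. AE x in M. \<forall>t\<in>{0..1}. P (\<epsilon>, t, x))"

text \<open>The exceptional null set may depend on \<epsilon> but serves all t at once; bounds
  uniform in t rest on this order of quantifiers.\<close>

lemma eventually_aefilter:
  "eventually P (aefilter M) \<longleftrightarrow> (\<forall>\<^sub>F \<epsilon> in at 0. AE x in M. \<forall>t\<in>{0..1}. P (\<epsilon>, t, x))"
  unfolding aefilter_def
proof (rule eventually_Abs_filter, rule is_filter.intro)
  fix P Q :: "real \<times> real \<times> 'a \<Rightarrow> bool"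
  assume "\<forall>\<^sub>F \<epsilon> in at 0. AE x in M. \<forall>t\<in>{0..1}. P (\<epsilon>, t, x)"
    and "\<forall>\<^sub>F \<epsilon> in at 0. AE x in M. \<forall>t\<in>{0..1}. Q (\<epsilon>, t, x)"
  then show "\<forall>\<^sub>F \<epsilon> in at 0. AE x in M. \<forall>t\<in>{0..1}. P (\<epsilon>, t, x) \<and> Q (\<epsilon>, t, x)"
    by eventually_elim auto
next
  fix P Q :: "real \<times> real \<times> 'a \<Rightarrow> bool"
  assume "\<forall>x. P x \<longrightarrow> Q x" and "\<forall>\<^sub>F \<epsilon> in at 0. AE x in M. \<forall>t\<in>{0..1}. P (\<epsilon>, t, x)"
  then show "\<forall>\<^sub>F \<epsilon> in at 0. AE x in M. \<forall>t\<in>{0..1}. Q (\<epsilon>, t, x)"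
    by (auto elim!: eventually_mono)
qed auto

lemma eventually_aefilterI:
  "\<forall>\<^sub>F \<epsilon> in at 0. P \<epsilon> \<Longrightarrow> \<forall>\<^sub>F c in aefilter M. P (fst c)"
  by (auto simp: eventually_aefilter elim!: eventually_mono)

lemma eventually_aefilter_AE:
  "AE x in M. P x \<Longrightarrow> \<forall>\<^sub>F c in aefilter M. P (snd (snd c))"
  by (auto simp: eventually_aefilter)

lemma filterlim_fst_aefilter: "filterlim fst (at 0) (aefilter M)"
  by (auto simp: filterlim_iff intro: eventually_aefilterI)

lemma bigo_aefilter_param: "(\<lambda>c. fst (snd c)) \<in> O[aefilter M](\<lambda>_. 1)"
  by (rule bigoI[of _ 1]) (auto simp: eventually_aefilter)

lemma rel_bounded_bound:
  assumes "rel_bounded M p h"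
  obtains C where "0 \<le> C" "AE x in M. \<bar>h x / p x\<bar> \<le> C"
proof -
  define S where "S = esssup M (\<lambda>x. ereal \<bar>h x / p x\<bar>)"
  have "S < \<infinity>" using assms by (simp add: rel_bounded_def S_def)
  then obtain C where "S \<le> ereal C" by (cases S) auto
  have "AE x in M. ereal \<bar>h x / p x\<bar> \<le> S" unfolding S_def by (rule esssup_AE)
  then have "AE x in M. \<bar>h x / p x\<bar> \<le> max 0 C"
  proof eventually_elim
    case (elim x)
    from order_trans[OF elim \<open>S \<le> ereal C\<close>] show ?case by simp
  qed
  then show ?thesis by (intro that[of "max 0 C"]) auto
qed

lemma bigo_aefilter_rel_bounded:
  assumes "rel_bounded M p h"
  shows "(\<lambda>c. h (snd (snd c)) / p (snd (snd c))) \<in> O[aefilter M](\<lambda>_. 1)"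
proof -
  obtain C where "AE x in M. \<bar>h x / p x\<bar> \<le> C" using rel_bounded_bound[OF assms] by metis
  from eventually_aefilter_AE[OF this] show ?thesis by (intro bigoI[of _ C]) auto
qed

text \<open>Boundedness excludes the infinite essential supremum, which \<open>real_of_ereal\<close>
  would send to 0.\<close>

lemma rel_norm_AE_bound:
  assumes "rel_bounded M p h"
  shows "AE x in M. \<bar>h x / p x\<bar> \<le> rel_norm M p h"
proof -
  define S where "S = esssup M (\<lambda>x. ereal \<bar>h x / p x\<bar>)"
  have "S < \<infinity>" using assms by (simp add: rel_bounded_def S_def)
  have "AE x in M. ereal \<bar>h x / p x\<bar> \<le> S" unfolding S_def by (rule esssup_AE)
  then show ?thesis
    unfolding rel_norm_def S_def[symmetric] using \<open>S < \<infinity>\<close> by (cases S) auto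
qed

lemma rel_norm_le:
  assumes "h \<in> borel_measurable M" "p \<in> borel_measurable M" "emeasure M (space M) \<noteq> 0"
    and bound: "AE x in M. \<bar>h x / p x\<bar> \<le> C"
  shows "rel_bounded M p h" "\<bar>rel_norm M p h\<bar> \<le> C"
proof -
  define S where "S = esssup M (\<lambda>x. ereal \<bar>h x / p x\<bar>)"
  have le: "S \<le> ereal C" unfolding S_def
    using assms by (intro esssup_I) auto
  \<comment> \<open>Comparison with the zero function excludes the value minus infinity, which the
    essential supremum takes on a null space.\<close>
  have "0 = esssup M (\<lambda>x. 0 :: ereal)" using esssup_const assms(3) by metis
  also have "\<dots> \<le> S" unfolding S_def by (intro esssup_mono) auto
  finally have "0 \<le> S" .
  then show "rel_bounded M p h" "\<bar>rel_norm M p h\<bar> \<le> C"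
    using le assms(1) unfolding rel_bounded_def rel_norm_def S_def[symmetric] by (cases S; auto)+
qed

text \<open>The way into the Landau calculus: the norm is itself an almost everywhere bound for the
  remainder, and the remainder does not involve t.\<close>

lemma rel_smallo_imp_aefilter:
  assumes "rel_smallo M p k R"
  shows "(\<lambda>c. R (fst c) (snd (snd c)) / p (snd (snd c))) \<in> o[aefilter M](\<lambda>c. fst c ^ k)"
proof (rule landau_o.smallI)
  fix c :: real assume "c > 0"
  from assms have "\<forall>\<^sub>F \<epsilon> in at 0. rel_bounded M p (R \<epsilon>)"
    and "(\<lambda>\<epsilon>. rel_norm M p (R \<epsilon>)) \<in> o[at 0](\<lambda>\<epsilon>. \<epsilon> ^ k)"
    by (auto simp: rel_smallo_def)
  from this(1) landau_o.smallD[OF this(2) \<open>c > 0\<close>]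
  have "\<forall>\<^sub>F \<epsilon> in at 0. AE x in M. \<forall>t\<in>{0..1::real}. norm (R \<epsilon> x / p x) \<le> c * norm (\<epsilon> ^ k)"
  proof eventually_elim
    case (elim \<epsilon>)
    from rel_norm_AE_bound[OF elim(1)] show ?case
      using elim(2) by (auto elim!: eventually_mono)
  qed
  then show "\<forall>\<^sub>F c' in aefilter M. norm (R (fst c') (snd (snd c')) / p (snd (snd c'))) \<le> c * norm (fst c' ^ k)"
    by (simp add: eventually_aefilter)
qed

text \<open>The way back to the norm. Passing from an almost everywhere bound to the essential
  supremum uses measurability and a space of positive measure.\<close>

lemma aefilter_imp_rel_smallo:
  assumes meas: "\<forall>\<^sub>F \<epsilon> in at 0. R \<epsilon> \<in> borel_measurable M" "p \<in> borel_measurable M"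
    and nontrivial: "emeasure M (space M) \<noteq> 0"
    and small: "(\<lambda>c. R (fst c) (snd (snd c)) / p (snd (snd c))) \<in> o[aefilter M](\<lambda>c. fst c ^ k)"
  shows "rel_smallo M p k R"
proof -
  have *: "\<forall>\<^sub>F \<epsilon> in at 0. rel_bounded M p (R \<epsilon>) \<and> \<bar>rel_norm M p (R \<epsilon>)\<bar> \<le> c * norm (\<epsilon> ^ k)" if "c > 0" for c
  proof -
    from landau_o.smallD[OF small that]
    have "\<forall>\<^sub>F \<epsilon> in at 0. AE x in M. \<forall>t\<in>{0..1::real}. norm (R \<epsilon> x / p x) \<le> c * norm (\<epsilon> ^ k)"
      by (simp add: eventually_aefilter)
    with meas(1) show ?thesis
    proof eventually_elim
      case (elim \<epsilon>)
      from elim(2) have "AE x in M. \<bar>R \<epsilon> x / p x\<bar> \<le> c * norm (\<epsilon> ^ k)"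
        by (auto elim!: eventually_mono)
      from rel_norm_le[OF elim(1) meas(2) nontrivial this] show ?case by blast
    qed
  qed
  show ?thesis
    unfolding rel_smallo_def
  proof
    show "\<forall>\<^sub>F \<epsilon> in at 0. rel_bounded M p (R \<epsilon>)" using *[of 1] by (auto elim!: eventually_mono)
    show "(\<lambda>\<epsilon>. rel_norm M p (R \<epsilon>)) \<in> o[at 0](\<lambda>\<epsilon>. \<epsilon> ^ k)"
    proof (rule landau_o.smallI)
      fix c :: real assume "c > 0"
      from *[OF this] show "\<forall>\<^sub>F \<epsilon> in at 0. norm (rel_norm M p (R \<epsilon>)) \<le> c * norm (\<epsilon> ^ k)"
        by (auto elim!: eventually_mono)
    qed
  qed
qed

section \<open>Convexity along the segment\<close>

text \<open>Densities may vanish on a null set, where the arbitrary value \<open>f 0\<close> enters the integrand.\<close>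
lemma convex_on_positive_measurable_compose:
  fixes f :: "real \<Rightarrow> real"
  assumes "convex_on {0<..} f" and g: "g \<in> borel_measurable M" and nonneg: "\<And>x. x \<in> space M \<Longrightarrow> 0 \<le> g x"
  shows "(\<lambda>x. f (g x)) \<in> borel_measurable M"
proof -
  have "continuous_on {0<..} f" using assms(1) by (intro convex_on_continuous) auto
  then have "f \<in> borel_measurable (restrict_space borel {0<..})"
    by (rule borel_measurable_continuous_on_restrict)
  \<comment> \<open>A constant extension of \<open>f\<close> from the positive reals is Borel on the
    whole line and agrees with \<open>f\<close> at all values of \<open>g\<close>, zero
    included.\<close>
  then have "(\<lambda>y. if y \<in> {0<..} then f y else f 0) \<in> borel_measurable borel"
    by (subst measurable_If_restrict_space_iff) (auto simp: pred_def greaterThan_def)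
  from measurable_compose[OF g this]
  have "(\<lambda>x. if g x \<in> {0<..} then f (g x) else f 0) \<in> borel_measurable M" .
  moreover have "(if g x \<in> {0<..} then f (g x) else f 0) = f (g x)" if "x \<in> space M" for x
    using nonneg[OF that] by (cases "g x = 0") auto
  ultimately show ?thesis by (subst (asm) measurable_cong)
qed

text \<open>The perspective q f(v/q) is convex in q > 0, and q is affine in t.\<close>

lemma perspective_segment_convex:
  fixes f :: "real \<Rightarrow> real"
  assumes f: "convex_on {0<..} f" and pos: "0 < v" "0 < w"
  shows "convex_on {0..1} (\<lambda>t. ((1 - t) * v + t * w) * f (v / ((1 - t) * v + t * w)))"
proof (rule convex_onI)
  fix l x y :: real assume l: "0 < l" "l < 1" and xy: "x \<in> {0..1}" "y \<in> {0..1}"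
  define q where "q = (\<lambda>t. (1 - t) * v + t * w)"
  have q_pos: "0 < q t" if "t \<in> {0..1}" for t
  proof (cases "t = 0")
    case True
    then show ?thesis using pos by (simp add: q_def)
  next
    case False
    then show ?thesis using pos that unfolding q_def by (intro add_nonneg_pos) auto
  qed
  let ?z = "(1 - l) *\<^sub>R x + l *\<^sub>R y"
  define Z where "Z = q ?z"
  \<comment> \<open>The weight \<open>l\<close> is rescaled by the values of \<open>q\<close>, which
    makes \<open>v / Z\<close> the convex combination of \<open>v / q x\<close> and
    \<open>v / q y\<close>. Jensen's inequality multiplied by \<open>Z\<close> then restores the
    weights \<open>1 - l\<close> and \<open>l\<close>.\<close>
  define m where "m = l * q y / Z"
  have qz: "Z = (1 - l) * q x + l * q y" by (simp add: Z_def q_def algebra_simps)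
  have qz_pos: "0 < Z" unfolding qz using l q_pos xy by (intro add_pos_pos) auto
  have m: "0 \<le> m" "m \<le> 1" "1 - m = (1 - l) * q x / Z"
    unfolding m_def using qz_pos l q_pos[OF xy(1)] q_pos[OF xy(2)] by (auto simp: qz field_simps)
  have "v / Z = (1 - m) *\<^sub>R (v / q x) + m *\<^sub>R (v / q y)"
    unfolding m(3) using q_pos[OF xy(1)] q_pos[OF xy(2)] qz_pos
    by (simp add: m_def add_divide_distrib[symmetric]) (simp add: algebra_simps)
  then have "f (v / Z) \<le> (1 - m) * f (v / q x) + m * f (v / q y)"
    using convex_onD[OF f m(1,2), of "v / q x" "v / q y"] q_pos xy pos by simp
  then have "Z * f (v / Z) \<le> Z * ((1 - m) * f (v / q x) + m * f (v / q y))"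
    using qz_pos by (intro mult_left_mono) auto
  also have "\<dots> = (1 - l) * (q x * f (v / q x)) + l * (q y * f (v / q y))"
    unfolding m(3) using qz_pos by (simp add: m_def field_simps)
  finally show "((1 - ?z) * v + ?z * w) * f (v / ((1 - ?z) * v + ?z * w))
      \<le> (1 - l) * (((1 - x) * v + x * w) * f (v / ((1 - x) * v + x * w))) +
         l * (((1 - y) * v + y * w) * f (v / ((1 - y) * v + y * w)))"
    by (simp add: q_def Z_def)
qed auto

lemma f_div_segment_convex:
  assumes f: "convex_on {0<..} f" and pos: "AE x in M. 0 < r x" "AE x in M. 0 < s x"
    and int: "\<And>t. t \<in> {0..1} \<Longrightarrow> integrable M (\<lambda>x. segment t r s x * f (r x / segment t r s x))"
  shows "convex_on {0..1} (\<lambda>t. f_div M f r (segment t r s))"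
proof (rule convex_onI)
  fix l x y :: real assume l: "0 < l" "l < 1" and xy: "x \<in> {0..1}" "y \<in> {0..1}"
  let ?z = "(1 - l) *\<^sub>R x + l *\<^sub>R y"
  let ?g = "\<lambda>t x. segment t r s x * f (r x / segment t r s x)"
  have z: "?z \<in> {0..1}"
    using convexD[of "{0..1::real}" x y "1 - l" l] l xy by auto
  have "f_div M f r (segment ?z r s) \<le> (LINT \<omega>|M. (1 - l) * ?g x \<omega> + l * ?g y \<omega>)"
    unfolding f_div_def
  proof (intro integral_mono_AE int z Bochner_Integration.integrable_add integrable_mult_right xy)
    show "AE \<omega> in M. ?g ?z \<omega> \<le> (1 - l) * ?g x \<omega> + l * ?g y \<omega>"
      using pos
    proof eventually_elim
      case (elim \<omega>)
      from convex_onD[OF perspective_segment_convex[OF f elim] _ _ xy, of l] l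
      show ?case by (simp add: segment_def)
    qed
  qed
  also have "\<dots> = (1 - l) * f_div M f r (segment x r s) + l * f_div M f r (segment y r s)"
    unfolding f_div_def using int[OF xy(1)] int[OF xy(2)] by simp
  finally show "f_div M f r (segment ?z r s) \<le> \<dots>" .
qed auto

lemma f_div_segment_0:
  assumes "f 1 = 0" "AE x in M. 0 < r x"
  shows "f_div M f r (segment 0 r s) = 0"
  unfolding f_div_def
  by (rule integral_eq_zero_AE) (use assms in \<open>auto simp: segment_def elim!: eventually_mono\<close>)

text \<open>Transfers facts about the divergence from \<open>r\<close> to the divergence from
  \<open>s\<close>.\<close>

lemma segment_flip: "segment t r s = segment (1 - t) s r"
  by (auto simp: segment_def)

text \<open>Convexity and the zero at 0 make \<open>\<phi> x / x\<close> nondecreasing. Positivity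
  thus spreads from \<open>d\<close> to the right, and there \<open>\<phi>\<close> grows at least
  proportionally to its argument.\<close>

lemma convex_on_strict_mono_beyond_positive:
  fixes \<phi> :: "real \<Rightarrow> real"
  assumes conv: "convex_on {0..1} \<phi>" and "\<phi> 0 = 0" "0 < d" "0 < \<phi> d"
  shows "strict_mono_on {d..1} \<phi>"
proof (rule strict_mono_onI)
  have scale: "\<phi> x \<le> x / y * \<phi> y" if "0 \<le> x" "x < y" "y \<le> 1" for x y
    using convex_onD[OF conv, of "x / y" 0 y] that assms by simp
  fix x y assume xy: "x \<in> {d..1}" "y \<in> {d..1}" "x < y"
  have "0 < \<phi> x"
  proof (cases "d = x")
    case False
    then have "0 < d / x * \<phi> x" using scale[of d x] xy assms by auto
    then show ?thesis using xy assms zero_less_mult_pos[of "d / x" "\<phi> x"] by auto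
  qed (use assms in simp)
  moreover have "\<phi> x \<le> x / y * \<phi> y" using scale[of x y] xy assms by auto
  ultimately have p: "0 < \<phi> y" using xy assms
    by (smt (verit) atLeastAtMost_iff divide_pos_pos zero_less_mult_pos)
  have "x / y < 1" using xy assms by auto
  then have "x / y * \<phi> y < \<phi> y" using p mult_strict_right_mono[of "x / y" 1 "\<phi> y"] by simp
  with \<open>\<phi> x \<le> x / y * \<phi> y\<close> show "\<phi> x < \<phi> y" by simp
qed

section \<open>Roots of a perturbed balance\<close>

text \<open>The leading term has the factor \<open>t - t_zero a b\<close>. At a root, division by
  \<epsilon>^3 balances the cofactor times the difference quotient of \<open>T\<close> against the
  third-order coefficient \<open>E\<close>, and the cofactor is nonzero at
  \<open>t_zero a b\<close>.\<close>

lemma balancing_root_slope: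
  fixes G :: "real \<Rightarrow> real \<Rightarrow> real"
  assumes ab: "0 < a" "0 < b" and c0: "0 < c0"
    and expansion: "\<And>c. 0 < c \<Longrightarrow> \<forall>\<^sub>F \<epsilon> in at 0. \<forall>t\<in>{0..1}.
      \<bar>G \<epsilon> t - (\<epsilon>\<^sup>2 * (c0 * (a * t\<^sup>2 - b * (1 - t)\<^sup>2)) + \<epsilon> ^ 3 * E t)\<bar> \<le> c * \<bar>\<epsilon>\<bar> ^ 3"
    and T: "(T \<longlongrightarrow> t_zero a b) (at 0)" "\<forall>\<^sub>F \<epsilon> in at 0. T \<epsilon> \<in> {0..1} \<and> G \<epsilon> (T \<epsilon>) = 0"
    and E: "isCont E (t_zero a b)"
  shows "(\<lambda>\<epsilon>. T \<epsilon> - (t_zero a b + \<epsilon> * (- E (t_zero a b) / (2 * c0 * (sqrt a * sqrt b))))) \<in> o[at 0](\<lambda>\<epsilon>. \<epsilon>)"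
proof -
  \<comment> \<open>The cofactor of \<open>t - t_zero a b\<close> when
    \<open>a * t^2 - b * (1 - t)^2\<close> is factored as a difference of squares.\<close>
  define k where "k = (\<lambda>t. c0 * (sqrt a + sqrt b) * (sqrt a * t + sqrt b * (1 - t)))"
  have sab: "sqrt a > 0" "sqrt b > 0" "sqrt a + sqrt b > 0" using ab by (auto intro: add_pos_pos)
  have t1: "1 - t_zero a b = sqrt a / (sqrt a + sqrt b)" using sab by (simp add: t_zero_def field_simps)
  have k0: "k (t_zero a b) = 2 * c0 * (sqrt a * sqrt b)"
  proof -
    define S where "S = sqrt a + sqrt b"
    have "k (t_zero a b) = c0 * S * (sqrt a * (sqrt b / S) + sqrt b * (sqrt a / S))"
      unfolding k_def S_def by (subst t1) (simp add: t_zero_def)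
    then show ?thesis using sab(3)[folded S_def] by (simp add: field_simps)
  qed
  have fact: "c0 * (a * t\<^sup>2 - b * (1 - t)\<^sup>2) = k t * (t - t_zero a b)" for t
  proof -
    have "(sqrt a + sqrt b) * (t - t_zero a b) = sqrt a * t - sqrt b * (1 - t)"
      using sab by (simp add: t_zero_def field_simps)
    moreover have "a = sqrt a ^ 2" "b = sqrt b ^ 2" using ab by auto
    ultimately show ?thesis unfolding k_def by algebra
  qed
  \<comment> \<open>Uniformity of the expansion in t permits inserting the moving point
    \<open>T \<epsilon>\<close>, at which \<open>G\<close> vanishes.\<close>
  have lim0: "((\<lambda>\<epsilon>. k (T \<epsilon>) * ((T \<epsilon> - t_zero a b) / \<epsilon>) + E (T \<epsilon>)) \<longlongrightarrow> 0) (at 0)"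
  proof (rule tendstoI)
    fix e :: real assume "e > 0"
    then have "\<forall>\<^sub>F \<epsilon> in at (0::real). \<epsilon> \<noteq> 0" "e / 2 > 0" by (auto simp: eventually_at_filter)
    from this(1) T(2) expansion[OF this(2)]
    show "\<forall>\<^sub>F \<epsilon> in at 0. dist (k (T \<epsilon>) * ((T \<epsilon> - t_zero a b) / \<epsilon>) + E (T \<epsilon>)) 0 < e"
    proof eventually_elim
      case (elim \<epsilon>)
      have "\<bar>\<epsilon>\<^sup>2 * (k (T \<epsilon>) * (T \<epsilon> - t_zero a b)) + \<epsilon> ^ 3 * E (T \<epsilon>)\<bar> \<le> e / 2 * \<bar>\<epsilon>\<bar> ^ 3"
        using bspec[OF elim(3), of "T \<epsilon>"] elim(2) unfolding fact by (metis diff_0 abs_minus_cancel)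
      also have "\<epsilon>\<^sup>2 * (k (T \<epsilon>) * (T \<epsilon> - t_zero a b)) + \<epsilon> ^ 3 * E (T \<epsilon>)
         = \<epsilon> ^ 3 * (k (T \<epsilon>) * ((T \<epsilon> - t_zero a b) / \<epsilon>) + E (T \<epsilon>))"
        using elim(1) by (simp add: field_simps power2_eq_square power3_eq_cube)
      finally have "\<bar>k (T \<epsilon>) * ((T \<epsilon> - t_zero a b) / \<epsilon>) + E (T \<epsilon>)\<bar> \<le> e / 2"
        using elim(1) by (simp add: abs_mult power_abs)
      then show ?case using \<open>e > 0\<close> by (simp add: dist_real_def)
    qed
  qed
  have "((\<lambda>\<epsilon>. k (T \<epsilon>)) \<longlongrightarrow> k (t_zero a b)) (at 0)"
    unfolding k_def by (intro tendsto_intros T(1))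
  moreover have "((\<lambda>\<epsilon>. E (T \<epsilon>)) \<longlongrightarrow> E (t_zero a b)) (at 0)"
    using isCont_tendsto_compose[OF E T(1)] .
  moreover have knz: "k (t_zero a b) \<noteq> 0" unfolding k0 using c0 sab by simp
  ultimately have "((\<lambda>\<epsilon>. ((k (T \<epsilon>) * ((T \<epsilon> - t_zero a b) / \<epsilon>) + E (T \<epsilon>)) - E (T \<epsilon>)) / k (T \<epsilon>)) \<longlongrightarrow>
      (0 - E (t_zero a b)) / k (t_zero a b)) (at 0)"
    by (intro tendsto_intros lim0)
  moreover have "\<forall>\<^sub>F \<epsilon> in at 0. k (T \<epsilon>) \<noteq> 0"
    using tendsto_imp_eventually_ne[OF \<open>((\<lambda>\<epsilon>. k (T \<epsilon>)) \<longlongrightarrow> k (t_zero a b)) (at 0)\<close> knz] .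
  then have "\<forall>\<^sub>F \<epsilon> in at 0. ((k (T \<epsilon>) * ((T \<epsilon> - t_zero a b) / \<epsilon>) + E (T \<epsilon>)) - E (T \<epsilon>)) / k (T \<epsilon>)
      = (T \<epsilon> - t_zero a b) / \<epsilon>"
    by eventually_elim simp
  ultimately have lim: "((\<lambda>\<epsilon>. (T \<epsilon> - t_zero a b) / \<epsilon>) \<longlongrightarrow> - E (t_zero a b) / k (t_zero a b)) (at 0)"
    using Lim_transform_eventually by fastforce
  show ?thesis
    unfolding k0[symmetric]
  proof (rule smalloI_tendsto)
    have ne: "\<forall>\<^sub>F \<epsilon> in at (0::real). \<epsilon> \<noteq> 0" by (auto simp: eventually_at_filter)
    then show "\<forall>\<^sub>F \<epsilon> in at (0::real). \<epsilon> \<noteq> 0" .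
    have "((\<lambda>\<epsilon>. (T \<epsilon> - t_zero a b) / \<epsilon> - (- E (t_zero a b) / k (t_zero a b))) \<longlongrightarrow> 0) (at 0)"
      using tendsto_diff[OF lim tendsto_const[of "- E (t_zero a b) / k (t_zero a b)"]] by simp
    then show "((\<lambda>\<epsilon>. (T \<epsilon> - (t_zero a b + \<epsilon> * (- E (t_zero a b) / k (t_zero a b)))) / \<epsilon>) \<longlongrightarrow> 0) (at 0)"
      by (rule Lim_transform_eventually) (use ne in \<open>eventually_elim, simp add: diff_divide_distrib add_divide_distrib\<close>)
  qed
qed

text \<open>The leading term is even in \<epsilon>, and it dominates once
  \<open>\<bar>\<epsilon>\<bar> * (\<bar>Q\<bar> + 1) < L\<close>, whatever the signs of \<epsilon>
  and \<open>Q\<close>.\<close>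

lemma eventually_pos_leading_order:
  fixes g :: "real \<Rightarrow> real"
  assumes g: "\<forall>\<^sub>F \<epsilon> in at 0. \<bar>g \<epsilon> - (\<epsilon>\<^sup>2 * L + \<epsilon> ^ 3 * Q)\<bar> \<le> \<bar>\<epsilon>\<bar> ^ 3" and L: "0 < L"
  shows "\<forall>\<^sub>F \<epsilon> in at 0. 0 < g \<epsilon>"
proof -
  have "((\<lambda>\<epsilon>::real. \<bar>\<epsilon>\<bar> * (\<bar>Q\<bar> + 1)) \<longlongrightarrow> \<bar>0\<bar> * (\<bar>Q\<bar> + 1)) (at 0)"
    by (intro tendsto_intros)
  then have "\<forall>\<^sub>F \<epsilon> in at (0::real). \<bar>\<epsilon>\<bar> * (\<bar>Q\<bar> + 1) < L"
    by (rule order_tendstoD) (use L in simp)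
  moreover have "\<forall>\<^sub>F \<epsilon> in at (0::real). \<epsilon> \<noteq> 0" by (auto simp: eventually_at_filter)
  ultimately show ?thesis
    using g
  proof eventually_elim
    case (elim \<epsilon>)
    from elim(3) have "\<epsilon>\<^sup>2 * L - \<bar>\<epsilon> ^ 3 * Q\<bar> - \<bar>\<epsilon>\<bar> ^ 3 \<le> g \<epsilon>" by linarith
    moreover have "\<epsilon>\<^sup>2 * L - \<bar>\<epsilon> ^ 3 * Q\<bar> - \<bar>\<epsilon>\<bar> ^ 3 = \<epsilon>\<^sup>2 * (L - \<bar>\<epsilon>\<bar> * (\<bar>Q\<bar> + 1))"
    proof -
      have "\<bar>\<epsilon>\<bar> ^ 3 = \<epsilon>\<^sup>2 * \<bar>\<epsilon>\<bar>" by (simp add: power3_eq_cube power2_eq_square)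
      then show ?thesis by (simp add: abs_mult power_abs algebra_simps)
    qed
    moreover have "0 < \<epsilon>\<^sup>2 * (L - \<bar>\<epsilon>\<bar> * (\<bar>Q\<bar> + 1))"
      using elim by simp
    ultimately show ?case by linarith
  qed
qed

text \<open>The leading term changes sign at \<open>t_zero a b\<close>, so the intermediate value
  theorem gives a root in each small interval around it; strict monotonicity away from 0 and 1 makes
  the root unique.\<close>

lemma root_near_leading_root:
  fixes G :: "real \<Rightarrow> real \<Rightarrow> real"
  assumes ab: "0 < a" "0 < b" and c0: "0 < c0"
    and expansion: "\<forall>\<^sub>F \<epsilon> in at 0. \<forall>t\<in>{0..1}.
      \<bar>G \<epsilon> t - (\<epsilon>\<^sup>2 * (c0 * (a * t\<^sup>2 - b * (1 - t)\<^sup>2)) + \<epsilon> ^ 3 * E t)\<bar> \<le> \<bar>\<epsilon>\<bar> ^ 3"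
    and cont: "\<forall>\<^sub>F \<epsilon> in at 0. continuous_on {0<..<1} (G \<epsilon>)"
    and mono: "\<And>d. 0 < d \<Longrightarrow> d \<le> 1 \<Longrightarrow> \<forall>\<^sub>F \<epsilon> in at 0. strict_mono_on {d..1 - d} (G \<epsilon>)"
  obtains T \<delta> where "(T \<longlongrightarrow> t_zero a b) (at 0)" "0 < \<delta>"
    "\<forall>\<^sub>F \<epsilon> in at 0. {t \<in> {0..1}. \<bar>t - t_zero a b\<bar> < \<delta> \<and> G \<epsilon> t = 0} = {T \<epsilon>}"
proof -
  define t0 where "t0 = t_zero a b"
  have sab: "sqrt a > 0" "sqrt b > 0" "sqrt a + sqrt b > 0" using ab by (auto intro: add_pos_pos)
  have t0: "0 < t0" "t0 < 1" using sab by (auto simp: t0_def t_zero_def)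
  have bal: "sqrt a * t0 = sqrt b * (1 - t0)"
    using sab by (simp add: t0_def t_zero_def field_simps)
  \<comment> \<open>The half keeps every point at distance less than \<open>d\<close> from
    \<open>t0\<close> inside \<open>{d..1 - d}\<close>, where \<open>G\<close> is strictly
    monotone.\<close>
  define d where "d = min t0 (1 - t0) / 2"
  have d: "0 < d" "d \<le> 1" "2 * d \<le> t0" "2 * d \<le> 1 - t0" using t0 by (auto simp: d_def)
  have sq: "a * t\<^sup>2 = (sqrt a * t)\<^sup>2" "b * (1 - t)\<^sup>2 = (sqrt b * (1 - t))\<^sup>2" for t
    using ab by (auto simp: power_mult_distrib)
  have pos: "\<forall>\<^sub>F \<epsilon> in at 0. 0 < G \<epsilon> t" if t: "t0 < t" "t \<le> 1" for t
  proof (rule eventually_pos_leading_order)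
    show "\<forall>\<^sub>F \<epsilon> in at 0. \<bar>G \<epsilon> t - (\<epsilon>\<^sup>2 * (c0 * (a * t\<^sup>2 - b * (1 - t)\<^sup>2)) + \<epsilon> ^ 3 * E t)\<bar> \<le> \<bar>\<epsilon>\<bar> ^ 3"
      using expansion by eventually_elim (use t t0 in auto)
    have "sqrt b * (1 - t) < sqrt b * (1 - t0)" "sqrt a * t0 < sqrt a * t" using t sab by auto
    then have "sqrt b * (1 - t) < sqrt a * t" using bal by linarith
    then have "(sqrt b * (1 - t))\<^sup>2 < (sqrt a * t)\<^sup>2"
      using t sab by (intro power_strict_mono) auto
    then show "0 < c0 * (a * t\<^sup>2 - b * (1 - t)\<^sup>2)" using c0 unfolding sq by simp
  qed
  have neg: "\<forall>\<^sub>F \<epsilon> in at 0. 0 < - G \<epsilon> t" if t: "0 \<le> t" "t < t0" for t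
  proof (rule eventually_pos_leading_order)
    show "\<forall>\<^sub>F \<epsilon> in at 0. \<bar>- G \<epsilon> t - (\<epsilon>\<^sup>2 * (c0 * (b * (1 - t)\<^sup>2 - a * t\<^sup>2)) + \<epsilon> ^ 3 * (- E t))\<bar> \<le> \<bar>\<epsilon>\<bar> ^ 3"
      using expansion
    proof eventually_elim
      case (elim \<epsilon>)
      have "- G \<epsilon> t - (\<epsilon>\<^sup>2 * (c0 * (b * (1 - t)\<^sup>2 - a * t\<^sup>2)) + \<epsilon> ^ 3 * (- E t))
        = - (G \<epsilon> t - (\<epsilon>\<^sup>2 * (c0 * (a * t\<^sup>2 - b * (1 - t)\<^sup>2)) + \<epsilon> ^ 3 * E t))"
        by (simp add: algebra_simps)
      then show ?case using bspec[OF elim, of t] t t0 by (simp only: abs_minus_cancel) auto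
    qed
    have "sqrt b * (1 - t0) < sqrt b * (1 - t)" "sqrt a * t < sqrt a * t0" using t sab by auto
    then have "sqrt a * t < sqrt b * (1 - t)" using bal by linarith
    then have "(sqrt a * t)\<^sup>2 < (sqrt b * (1 - t))\<^sup>2"
      using t sab by (intro power_strict_mono) auto
    then show "0 < c0 * (b * (1 - t)\<^sup>2 - a * t\<^sup>2)" using c0 unfolding sq by simp
  qed
  \<comment> \<open>The radius \<eta> is free so that the same fact also yields convergence of the
    roots to \<open>t0\<close>.\<close>
  have ex: "\<forall>\<^sub>F \<epsilon> in at 0. \<exists>t. \<bar>t - t0\<bar> < \<eta> \<and> G \<epsilon> t = 0" if \<eta>: "0 < \<eta>" "\<eta> \<le> d" for \<eta>
  proof -
    have "\<forall>\<^sub>F \<epsilon> in at 0. 0 < G \<epsilon> (t0 + \<eta>)" using \<eta> d by (intro pos) auto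
    moreover have "\<forall>\<^sub>F \<epsilon> in at 0. 0 < - G \<epsilon> (t0 - \<eta>)" using \<eta> d by (intro neg) auto
    ultimately show ?thesis
      using cont
    proof eventually_elim
      case (elim \<epsilon>)
      have "continuous_on {t0 - \<eta>..t0 + \<eta>} (G \<epsilon>)"
        using elim(3) by (rule continuous_on_subset) (use \<eta> d in auto)
      with elim \<eta> obtain t where t: "t0 - \<eta> \<le> t" "t \<le> t0 + \<eta>" "G \<epsilon> t = 0"
        using IVT'[of "G \<epsilon>" "t0 - \<eta>" 0 "t0 + \<eta>"] by auto
      moreover have "t \<noteq> t0 - \<eta>" "t \<noteq> t0 + \<eta>" using t elim by auto
      ultimately show ?case by (intro exI[of _ t]) (auto simp: abs_less_iff)
    qed
  qed
  have uniq: "\<forall>\<^sub>F \<epsilon> in at 0. \<forall>t t'. \<bar>t - t0\<bar> < d \<and> G \<epsilon> t = 0 \<longrightarrow> \<bar>t' - t0\<bar> < d \<and> G \<epsilon> t' = 0 \<longrightarrow> t = t'"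
    using mono[OF d(1,2)]
  proof eventually_elim
    case (elim \<epsilon>)
    show ?case
    proof (intro allI impI)
      fix t t' assume t: "\<bar>t - t0\<bar> < d \<and> G \<epsilon> t = 0" and t': "\<bar>t' - t0\<bar> < d \<and> G \<epsilon> t' = 0"
      then have "t \<in> {d..1 - d}" "t' \<in> {d..1 - d}" using d by (auto simp: abs_less_iff)
      then show "t = t'"
        using strict_mono_on_eqD[OF elim, of t t'] t t' by auto
    qed
  qed
  \<comment> \<open>The description is meaningful only for \<epsilon> close to 0, where existence
    and uniqueness hold; elsewhere its value is arbitrary.\<close>
  define T where "T = (\<lambda>\<epsilon>. THE t. \<bar>t - t0\<bar> < d \<and> G \<epsilon> t = 0)"
  have T: "\<forall>\<^sub>F \<epsilon> in at 0. \<bar>T \<epsilon> - t0\<bar> < \<eta> \<and> G \<epsilon> (T \<epsilon>) = 0" if \<eta>: "0 < \<eta>" "\<eta> \<le> d" for \<eta>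
    using ex[OF \<eta>] uniq
  proof eventually_elim
    case (elim \<epsilon>)
    then obtain t where t: "\<bar>t - t0\<bar> < \<eta>" "G \<epsilon> t = 0" by blast
    then have "T \<epsilon> = t" unfolding T_def using elim(2) \<eta> by (intro the_equality) auto
    with t show ?case by simp
  qed
  have "(T \<longlongrightarrow> t0) (at 0)"
  proof (rule tendstoI)
    fix e :: real assume "0 < e"
    then have "\<forall>\<^sub>F \<epsilon> in at 0. \<bar>T \<epsilon> - t0\<bar> < min e d \<and> G \<epsilon> (T \<epsilon>) = 0" using d by (intro T) auto
    then show "\<forall>\<^sub>F \<epsilon> in at 0. dist (T \<epsilon>) t0 < e" by eventually_elim (auto simp: dist_real_def)
  qed
  moreover have "\<forall>\<^sub>F \<epsilon> in at 0. {t \<in> {0..1}. \<bar>t - t0\<bar> < d \<and> G \<epsilon> t = 0} = {T \<epsilon>}"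
    using T[OF d(1) order.refl] uniq
  proof eventually_elim
    case (elim \<epsilon>)
    moreover from elim have "T \<epsilon> \<in> {0..1}" using d by (auto simp: abs_less_iff)
    ultimately show ?case by blast
  qed
  ultimately show ?thesis using that d(1) unfolding t0_def by blast
qed

section \<open>Expansion of the divergences\<close>

lemma integral_combination:
  fixes c1 :: real
  assumes "integrable M g1" "integrable M g2" "integrable M g3" "integrable M g4"
  shows "(LINT x|M. c1 * g1 x + (c2 * g2 x - c3 * g3 x - c4 * g4 x)) =
    c1 * (LINT x|M. g1 x) + (c2 * (LINT x|M. g2 x) - c3 * (LINT x|M. g3 x) - c4 * (LINT x|M. g4 x))"
  using assms by simp

text \<open>The assumptions are symmetric in the two endpoints, so the locale can be interpreted
  within itself with the endpoints exchanged. The numbers \<open>A2\<close> and \<open>A3\<close>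
  are tied to \<open>f\<close> by \<open>taylor\<close>.\<close>

locale perturbed_densities =
  fixes M :: "'a measure" and p hA hB BA BB :: "'a \<Rightarrow> real" and r s :: "real \<Rightarrow> 'a \<Rightarrow> real"
    and f :: "real \<Rightarrow> real" and A2 A3 :: real
  assumes p_density: "prob_density M p"
    and p_pos: "x \<in> space M \<Longrightarrow> 0 < p x"
    and densities: "\<forall>\<^sub>F \<epsilon> in at 0. prob_density M (r \<epsilon>)" "\<forall>\<^sub>F \<epsilon> in at 0. prob_density M (s \<epsilon>)"
    and bounded: "rel_bounded M p hA" "rel_bounded M p hB" "rel_bounded M p BA" "rel_bounded M p BB"
    and r_expansion: "second_order_expansion M p r hA BA"
    and s_expansion: "second_order_expansion M p s hB BB"
    and f_convex: "convex_on {0<..} f"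
    and f_1: "f 1 = 0"
    and taylor: "(\<lambda>y. f (1 + y) - (A2 * y^2 + A3 * y^3)) \<in> o[nhds 0](\<lambda>y. y^3)"
begin

abbreviation "uA \<equiv> \<lambda>x. hA x / p x"
abbreviation "uB \<equiv> \<lambda>x. hB x / p x"
abbreviation "\<Delta> \<equiv> \<lambda>x. uB x - uA x"
abbreviation "\<Delta>\<^sub>2 \<equiv> \<lambda>x. BB x / p x - BA x / p x"
abbreviation "J \<equiv> J_const M p uA uB"
abbreviation "L3 \<equiv> L3_const M p uA uB"

text \<open>The third-order coefficient of the divergence contains
  \<open>A2 * t^2 * (K - I)\<close>. The difference \<open>K - I\<close> cancels from the balance at
  the leading root, so it does not enter the slope.\<close>

definition "K = (LINT x|M. (2 * \<Delta> x * \<Delta>\<^sub>2 x) * p x)"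
definition "I = (LINT x|M. ((\<Delta> x)^2 * uA x) * p x)"

lemma p_integrable: "integrable M p"
  and p_integral: "(LINT x|M. p x) = 1"
  using p_density by (auto simp: prob_density_def)

lemma measurables [measurable]:
  "p \<in> borel_measurable M" "hA \<in> borel_measurable M" "hB \<in> borel_measurable M"
  "BA \<in> borel_measurable M" "BB \<in> borel_measurable M"
  using bounded p_integrable by (auto simp: rel_bounded_def)

lemma nontrivial: "emeasure M (space M) \<noteq> 0"
proof
  assume "emeasure M (space M) = 0"
  then have "AE x in M. p x = 0" by (intro AE_I[of _ _ "space M"]) auto
  then have "(LINT x|M. p x) = 0" by (rule integral_eq_zero_AE)
  with p_integral show False by simp
qed

lemma p_pos_aefilter: "\<forall>\<^sub>F c in aefilter M. 0 < p (snd (snd c))"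
  by (rule eventually_aefilter_AE) (use p_pos in auto)

section \<open>Endpoints and segment relative to \<open>p\<close>\<close>

lemma relative_expansion:
  assumes "second_order_expansion M p r' h B"
  shows "(\<lambda>c. r' (fst c) (snd (snd c)) / p (snd (snd c)) - (1 + fst c * (h (snd (snd c)) / p (snd (snd c)))
      + (fst c)^2 * (B (snd (snd c)) / p (snd (snd c))))) \<in> o[aefilter M](\<lambda>c. fst c ^ 2)"
proof (subst landau_o.small.in_cong)
  show "\<forall>\<^sub>F c in aefilter M. r' (fst c) (snd (snd c)) / p (snd (snd c)) - (1 + fst c * (h (snd (snd c)) / p (snd (snd c)))
      + (fst c)^2 * (B (snd (snd c)) / p (snd (snd c))))
    = (r' (fst c) (snd (snd c)) - (p (snd (snd c)) + fst c * h (snd (snd c))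
      + (fst c)^2 * B (snd (snd c)))) / p (snd (snd c))"
    using p_pos_aefilter by eventually_elim (simp add: field_simps)
qed (rule assms[unfolded second_order_expansion_def, THEN rel_smallo_imp_aefilter])

text \<open>Relative to \<open>p\<close> the endpoint tends to 1 uniformly off null sets, hence is
  eventually at least 1/2. This upgrades nonnegativity to the positivity that convexity of
  \<open>f\<close> on the positive reals calls for.\<close>

lemma endpoint_AE_pos:
  assumes "second_order_expansion M p r' h B" "rel_bounded M p h" "rel_bounded M p B"
  shows "\<forall>\<^sub>F \<epsilon> in at 0. AE x in M. 0 < r' \<epsilon> x"
proof -
  let ?v = "\<lambda>c. r' (fst c) (snd (snd c)) / p (snd (snd c))"
  let ?R = "\<lambda>c. fst c * (h (snd (snd c)) / p (snd (snd c))) + (fst c)^2 * (B (snd (snd c)) / p (snd (snd c)))"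
  have E: "fst \<in> o[aefilter M](\<lambda>_. 1 :: real)"
    using filterlim_fst_aefilter[of M] by (intro smalloI_tendsto) (auto simp: filterlim_at)
  then have E2: "(\<lambda>c. fst c ^ 2) \<in> o[aefilter M](\<lambda>_. 1 :: real)"
    using landau_o.small_power[OF E, of 2] by simp
  have "(\<lambda>c. ?v c - (1 + fst c * (h (snd (snd c)) / p (snd (snd c)))
      + (fst c)^2 * (B (snd (snd c)) / p (snd (snd c)))) + ?R c) \<in> o[aefilter M](\<lambda>_. 1)"
    by (intro smallo_1_add smallo_1_mult E E2 bigo_aefilter_rel_bounded assms
        landau_o.small_trans[OF relative_expansion E2])
  from landau_o.smallD[OF this, of "1/2"]
  have "\<forall>\<^sub>F c in aefilter M. \<bar>?v c - 1\<bar> \<le> 1/2" by simp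
  with p_pos_aefilter have "\<forall>\<^sub>F c in aefilter M. 0 < r' (fst c) (snd (snd c))"
  proof eventually_elim
    case (elim c)
    then have "0 < ?v c" by linarith
    with elim(1) show ?case by (simp add: zero_less_divide_iff)
  qed
  then have "\<forall>\<^sub>F \<epsilon> in at 0. AE x in M. \<forall>t\<in>{0..1::real}. 0 < r' \<epsilon> x"
    by (simp add: eventually_aefilter)
  then show ?thesis by (rule eventually_mono) (auto elim!: eventually_mono)
qed

text \<open>The first-order change \<open>\<epsilon> * \<tau>\<close> of the weight multiplies a
  difference of endpoints that is itself of order \<epsilon>, and so shows up as
  \<open>\<tau> * (hB - hA)\<close> at second order.\<close>

lemma segment_expansion:
  assumes T: "(T \<longlongrightarrow> t0) (at 0)" and slope: "(\<lambda>\<epsilon>. T \<epsilon> - (t0 + \<epsilon> * \<tau>)) \<in> o[at 0](\<lambda>\<epsilon>. \<epsilon>)"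
  shows "second_order_expansion M p (\<lambda>\<epsilon>. segment (T \<epsilon>) (r \<epsilon>) (s \<epsilon>))
        (\<lambda>x. (1 - t0) * hA x + t0 * hB x)
        (\<lambda>x. (1 - t0) * BA x + t0 * BB x + \<tau> * (hB x - hA x))"
  unfolding second_order_expansion_def
proof (rule aefilter_imp_rel_smallo)
  let ?X = "\<lambda>c :: real \<times> real \<times> 'a. snd (snd c)"
  let ?Rr = "\<lambda>c. r (fst c) (?X c) - (p (?X c) + fst c * hA (?X c) + (fst c)\<^sup>2 * BA (?X c))"
  let ?Rs = "\<lambda>c. s (fst c) (?X c) - (p (?X c) + fst c * hB (?X c) + (fst c)\<^sup>2 * BB (?X c))"
  have TO: "(\<lambda>c. T (fst c)) \<in> O[aefilter M](\<lambda>_. 1)"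
    using landau_o.big.compose[OF bigoI_tendsto[of T "\<lambda>_. 1" t0 "at 0"] filterlim_fst_aefilter[of M]] T
    by simp
  have To: "(\<lambda>c. T (fst c) - t0) \<in> o[aefilter M](\<lambda>_. 1)"
  proof (rule landau_o.small.compose[OF _ filterlim_fst_aefilter])
    have "((\<lambda>\<epsilon>. T \<epsilon> - t0) \<longlongrightarrow> 0) (at 0)" using tendsto_diff[OF T tendsto_const[of t0]] by simp
    then show "(\<lambda>\<epsilon>. T \<epsilon> - t0) \<in> o[at 0](\<lambda>_. 1)" by (intro smalloI_tendsto) auto
  qed
  have small: "(\<lambda>c. T (fst c) - (t0 + fst c * \<tau>)) \<in> o[aefilter M](\<lambda>c. fst c)"
    by (rule landau_o.small.compose[OF slope filterlim_fst_aefilter])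
  have \<Delta>O: "(\<lambda>c. \<Delta> (?X c)) \<in> O[aefilter M](\<lambda>_. 1)" "(\<lambda>c. \<Delta>\<^sub>2 (?X c)) \<in> O[aefilter M](\<lambda>_. 1)"
    by (intro bigo_1_diff bigo_aefilter_rel_bounded bounded)+
  have R: "(\<lambda>c. ?Rr c / p (?X c)) \<in> o[aefilter M](\<lambda>c. fst c ^ 2)"
     "(\<lambda>c. ?Rs c / p (?X c)) \<in> o[aefilter M](\<lambda>c. fst c ^ 2)"
    using r_expansion[unfolded second_order_expansion_def, THEN rel_smallo_imp_aefilter]
      s_expansion[unfolded second_order_expansion_def, THEN rel_smallo_imp_aefilter] by simp_all
  \<comment> \<open>The remainder divided by \<open>p\<close> splits exactly into four terms: the
    two weighted endpoint remainders, the error of \<open>T\<close> to first order times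
    \<open>\<epsilon> * \<Delta>\<close>, and its error to order zero times
    \<open>\<epsilon>^2 * \<Delta>\<^sub>2\<close>.\<close>
  have 1: "(\<lambda>c. (1 - T (fst c)) * (?Rr c / p (?X c))) \<in> o[aefilter M](\<lambda>c. fst c ^ 2)"
    using landau_o.big_small_mult[OF bigo_1_diff[OF bigo_const[of 1] TO] R(1)] by simp
  have 2: "(\<lambda>c. T (fst c) * (?Rs c / p (?X c))) \<in> o[aefilter M](\<lambda>c. fst c ^ 2)"
    using landau_o.big_small_mult[OF TO R(2)] by simp
  have 3: "(\<lambda>c. fst c * ((T (fst c) - (t0 + fst c * \<tau>)) * \<Delta> (?X c))) \<in> o[aefilter M](\<lambda>c. fst c ^ 2)"
    using landau_o.big_small_mult[OF landau_o.big_refl landau_o.small_big_mult[OF small \<Delta>O(1)]]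
    by (simp add: power2_eq_square)
  have 4: "(\<lambda>c. fst c ^ 2 * ((T (fst c) - t0) * \<Delta>\<^sub>2 (?X c))) \<in> o[aefilter M](\<lambda>c. fst c ^ 2)"
    using landau_o.big_small_mult[OF landau_o.big_refl landau_o.small_big_mult[OF To \<Delta>O(2)]]
    by simp
  have "\<forall>\<^sub>F c in aefilter M. (1 - T (fst c)) * (?Rr c / p (?X c)) + T (fst c) * (?Rs c / p (?X c))
      + (fst c * ((T (fst c) - (t0 + fst c * \<tau>)) * \<Delta> (?X c)) + fst c ^ 2 * ((T (fst c) - t0) * \<Delta>\<^sub>2 (?X c)))
    = (segment (T (fst c)) (r (fst c)) (s (fst c)) (?X c) - (p (?X c) + fst c * ((1 - t0) * hA (?X c) + t0 * hB (?X c))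
      + (fst c)\<^sup>2 * ((1 - t0) * BA (?X c) + t0 * BB (?X c) + \<tau> * (hB (?X c) - hA (?X c))))) / p (?X c)"
    using p_pos_aefilter
    by eventually_elim (simp add: segment_def field_simps power2_eq_square)
  then show "(\<lambda>c. (segment (T (fst c)) (r (fst c)) (s (fst c)) (?X c) - (p (?X c) + fst c * ((1 - t0) * hA (?X c) + t0 * hB (?X c))
      + (fst c)\<^sup>2 * ((1 - t0) * BA (?X c) + t0 * BB (?X c) + \<tau> * (hB (?X c) - hA (?X c))))) / p (?X c))
      \<in> o[aefilter M](\<lambda>c. fst c ^ 2)"
    using sum_in_smallo(1)[OF sum_in_smallo(1)[OF 1 2] sum_in_smallo(1)[OF 3 4]]
    by (subst (asm) landau_o.small.in_cong)
  show "\<forall>\<^sub>F \<epsilon> in at 0. (\<lambda>x. segment (T \<epsilon>) (r \<epsilon>) (s \<epsilon>) x - (p x + \<epsilon> * ((1 - t0) * hA x + t0 * hB x) +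
           \<epsilon>\<^sup>2 * ((1 - t0) * BA x + t0 * BB x + \<tau> * (hB x - hA x)))) \<in> borel_measurable M"
    using densities
  proof eventually_elim
    case (elim \<epsilon>)
    then have [measurable]: "r \<epsilon> \<in> borel_measurable M" "s \<epsilon> \<in> borel_measurable M"
      by (auto simp: prob_density_def)
    show ?case unfolding segment_def by measurable
  qed
qed (use nontrivial in auto)

section \<open>Integrating the pointwise expansion against \<open>p\<close>\<close>

lemma p_mult_integrable:
  assumes g: "g \<in> borel_measurable M" and bound: "AE x in M. \<bar>g x\<bar> \<le> C"
  shows "integrable M (\<lambda>x. g x * p x)"
proof (rule Bochner_Integration.integrable_bound)
  show "integrable M (\<lambda>x. C * p x)" using p_integrable by simp
  show "AE x in M. norm (g x * p x) \<le> norm (C * p x)"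
    using bound by eventually_elim (auto simp: abs_mult intro!: mult_right_mono)
qed (use g in \<open>auto intro!: borel_measurable_times\<close>)

lemma bounded_coefficients:
  obtains C where "0 \<le> C" "AE x in M. \<bar>\<Delta> x\<bar> \<le> C \<and> \<bar>\<Delta>\<^sub>2 x\<bar> \<le> C \<and> \<bar>uA x\<bar> \<le> C"
proof -
  obtain C1 where C1: "0 \<le> C1" "AE x in M. \<bar>hA x / p x\<bar> \<le> C1" by (rule rel_bounded_bound[OF bounded(1)])
  obtain C2 where C2: "0 \<le> C2" "AE x in M. \<bar>hB x / p x\<bar> \<le> C2" by (rule rel_bounded_bound[OF bounded(2)])
  obtain C3 where C3: "0 \<le> C3" "AE x in M. \<bar>BA x / p x\<bar> \<le> C3" by (rule rel_bounded_bound[OF bounded(3)])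
  obtain C4 where C4: "0 \<le> C4" "AE x in M. \<bar>BB x / p x\<bar> \<le> C4" by (rule rel_bounded_bound[OF bounded(4)])
  note C = C1(1) C2(1) C3(1) C4(1)
  from C1(2) C2(2) C3(2) C4(2) have "AE x in M. \<bar>\<Delta> x\<bar> \<le> C1 + C2 + C3 + C4 \<and> \<bar>\<Delta>\<^sub>2 x\<bar> \<le> C1 + C2 + C3 + C4
      \<and> \<bar>uA x\<bar> \<le> C1 + C2 + C3 + C4"
    by eventually_elim (use C in linarith)
  with C show ?thesis by (intro that[of "C1 + C2 + C3 + C4"]) auto
qed

lemma coefficients_integrable:
  "integrable M (\<lambda>x. (\<Delta> x)^2 * p x)" "integrable M (\<lambda>x. (\<Delta> x)^3 * p x)"
  "integrable M (\<lambda>x. (2 * \<Delta> x * \<Delta>\<^sub>2 x) * p x)" "integrable M (\<lambda>x. ((\<Delta> x)^2 * uA x) * p x)"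
proof -
  obtain C where C: "0 \<le> C" and bd: "AE x in M. \<bar>\<Delta> x\<bar> \<le> C \<and> \<bar>\<Delta>\<^sub>2 x\<bar> \<le> C \<and> \<bar>uA x\<bar> \<le> C"
    by (rule bounded_coefficients)
  have "AE x in M. \<bar>(\<Delta> x)^2\<bar> \<le> C^2"
    using bd by eventually_elim (unfold power_abs, intro power_mono, auto)
  then show "integrable M (\<lambda>x. (\<Delta> x)^2 * p x)" by (intro p_mult_integrable) auto
  have "AE x in M. \<bar>(\<Delta> x)^3\<bar> \<le> C^3"
    using bd by eventually_elim (unfold power_abs, intro power_mono, auto)
  then show "integrable M (\<lambda>x. (\<Delta> x)^3 * p x)" by (intro p_mult_integrable) auto
  have "AE x in M. \<bar>2 * \<Delta> x * \<Delta>\<^sub>2 x\<bar> \<le> 2 * C * C"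
    using bd by eventually_elim (unfold abs_mult, use C in \<open>auto intro!: mult_mono\<close>)
  then show "integrable M (\<lambda>x. (2 * \<Delta> x * \<Delta>\<^sub>2 x) * p x)" by (intro p_mult_integrable) auto
  have "AE x in M. \<bar>(\<Delta> x)^2 * uA x\<bar> \<le> C^2 * C"
    using bd by eventually_elim (unfold abs_mult power_abs, use C in \<open>intro mult_mono power_mono; auto\<close>)
  then show "integrable M (\<lambda>x. ((\<Delta> x)^2 * uA x) * p x)" by (intro p_mult_integrable) auto
qed

definition "main_terms \<epsilon> t x = \<epsilon> ^ 2 * (A2 * t^2 * (\<Delta> x)^2)
   + \<epsilon> ^ 3 * (A2 * t^2 * (2 * \<Delta> x * \<Delta>\<^sub>2 x - (\<Delta> x)^2 * uA x) - (A2 + A3) * t^3 * (\<Delta> x)^3)"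

text \<open>Scaling both densities by \<open>1 / p\<close> leaves their quotient unchanged, so only
  the outer factor picks up \<open>1 / p\<close>.\<close>

lemma integrand_expansion:
  "(\<lambda>c. segment (fst (snd c)) (r (fst c)) (s (fst c)) (snd (snd c)) *
      f (r (fst c) (snd (snd c)) / segment (fst (snd c)) (r (fst c)) (s (fst c)) (snd (snd c))) / p (snd (snd c))
     - main_terms (fst c) (fst (snd c)) (snd (snd c))) \<in> o[aefilter M](\<lambda>c. fst c ^ 3)"
proof -
  let ?X = "\<lambda>c :: real \<times> real \<times> 'a. snd (snd c)" and ?t = "\<lambda>c :: real \<times> real \<times> 'a. fst (snd c)"
  let ?v = "\<lambda>c. r (fst c) (?X c) / p (?X c)" and ?w = "\<lambda>c. s (fst c) (?X c) / p (?X c)"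
  let ?q = "\<lambda>c. ?v c + ?t c * (?w c - ?v c)"
  have "(\<lambda>c. ?q c * f (?v c / ?q c) - main_terms (fst c) (?t c) (?X c)) \<in> o[aefilter M](\<lambda>c. fst c ^ 3)"
    unfolding main_terms_def
    by (rule scaled_divergence_expansion[OF taylor filterlim_fst_aefilter bigo_aefilter_param
        bigo_aefilter_rel_bounded[OF bounded(1)] bigo_aefilter_rel_bounded[OF bounded(2)]
        bigo_aefilter_rel_bounded[OF bounded(3)] bigo_aefilter_rel_bounded[OF bounded(4)]
        relative_expansion[OF r_expansion] relative_expansion[OF s_expansion]])
  moreover have "\<forall>\<^sub>F c in aefilter M. ?q c * f (?v c / ?q c) - main_terms (fst c) (?t c) (?X c) =
    segment (?t c) (r (fst c)) (s (fst c)) (?X c) *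
      f (r (fst c) (?X c) / segment (?t c) (r (fst c)) (s (fst c)) (?X c)) / p (?X c) - main_terms (fst c) (?t c) (?X c)"
    using p_pos_aefilter
  proof eventually_elim
    case (elim c)
    then have "?q c = segment (?t c) (r (fst c)) (s (fst c)) (?X c) / p (?X c)"
      by (simp add: segment_def field_simps)
    with elim show ?case by simp
  qed
  ultimately show ?thesis by (subst (asm) landau_o.small.in_cong)
qed

lemma main_terms_measurable [measurable]: "main_terms \<epsilon> t \<in> borel_measurable M"
  unfolding main_terms_def by measurable

lemma integral_main_terms:
  "integrable M (\<lambda>x. main_terms \<epsilon> t x * p x)"
  "(LINT x|M. main_terms \<epsilon> t x * p x) = \<epsilon>\<^sup>2 * (A2 * t\<^sup>2 * J) + \<epsilon> ^ 3 * (A2 * t\<^sup>2 * (K - I) - (A2 + A3) * t ^ 3 * L3)"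
proof -
  have eq: "main_terms \<epsilon> t x * p x = \<epsilon>\<^sup>2 * A2 * t\<^sup>2 * ((\<Delta> x)^2 * p x)
     + (\<epsilon> ^ 3 * A2 * t\<^sup>2 * ((2 * \<Delta> x * \<Delta>\<^sub>2 x) * p x) - \<epsilon> ^ 3 * A2 * t\<^sup>2 * (((\<Delta> x)^2 * uA x) * p x)
     - \<epsilon> ^ 3 * (A2 + A3) * t ^ 3 * ((\<Delta> x)^3 * p x))" for x
    unfolding main_terms_def by (simp only: ring_distribs mult_ac diff_diff_eq)
  show "integrable M (\<lambda>x. main_terms \<epsilon> t x * p x)"
    unfolding eq by (intro Bochner_Integration.integrable_add Bochner_Integration.integrable_diff
        integrable_mult_right coefficients_integrable)
  have "(LINT x|M. main_terms \<epsilon> t x * p x) = \<epsilon>\<^sup>2 * A2 * t\<^sup>2 * J + (\<epsilon> ^ 3 * A2 * t\<^sup>2 * K - \<epsilon> ^ 3 * A2 * t\<^sup>2 * I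
     - \<epsilon> ^ 3 * (A2 + A3) * t ^ 3 * L3)"
    unfolding eq K_def I_def J_const_def L3_const_def
    by (rule integral_combination; fact coefficients_integrable)
  then show "(LINT x|M. main_terms \<epsilon> t x * p x) = \<epsilon>\<^sup>2 * (A2 * t\<^sup>2 * J) + \<epsilon> ^ 3 * (A2 * t\<^sup>2 * (K - I) - (A2 + A3) * t ^ 3 * L3)"
    by (simp add: algebra_simps)
qed

lemma f_div_integrand_measurable:
  assumes "prob_density M (r \<epsilon>)" "prob_density M (s \<epsilon>)" "t \<in> {0..1}"
  shows "(\<lambda>x. segment t (r \<epsilon>) (s \<epsilon>) x * f (r \<epsilon> x / segment t (r \<epsilon>) (s \<epsilon>) x)) \<in> borel_measurable M"
proof -
  have [measurable]: "r \<epsilon> \<in> borel_measurable M" "s \<epsilon> \<in> borel_measurable M"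
    using assms by (auto simp: prob_density_def)
  have [measurable]: "segment t (r \<epsilon>) (s \<epsilon>) \<in> borel_measurable M" unfolding segment_def by measurable
  have [measurable]: "(\<lambda>x. f (r \<epsilon> x / segment t (r \<epsilon>) (s \<epsilon>) x)) \<in> borel_measurable M"
  proof (rule convex_on_positive_measurable_compose[OF f_convex])
    show "0 \<le> r \<epsilon> x / segment t (r \<epsilon>) (s \<epsilon>) x" if "x \<in> space M" for x
      using assms that unfolding segment_def prob_density_def
      by (intro divide_nonneg_nonneg add_nonneg_nonneg mult_nonneg_nonneg) auto
  qed measurable
  show ?thesis by measurable
qed

text \<open>An almost everywhere bound for the relative remainder survives integration against
  \<open>p\<close> with the same constant, since \<open>p\<close> has mass 1. Integrability is
  recorded along with it because the convexity argument integrates an inequality.\<close>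

lemma f_div_uniform_expansion:
  assumes "0 < c"
  shows "\<forall>\<^sub>F \<epsilon> in at 0. \<forall>t\<in>{0..1}.
    integrable M (\<lambda>x. segment t (r \<epsilon>) (s \<epsilon>) x * f (r \<epsilon> x / segment t (r \<epsilon>) (s \<epsilon>) x)) \<and>
    \<bar>f_div M f (r \<epsilon>) (segment t (r \<epsilon>) (s \<epsilon>)) -
      (\<epsilon>\<^sup>2 * (A2 * t\<^sup>2 * J) + \<epsilon> ^ 3 * (A2 * t\<^sup>2 * (K - I) - (A2 + A3) * t ^ 3 * L3))\<bar> \<le> c * \<bar>\<epsilon>\<bar> ^ 3"
proof -
  from landau_o.smallD[OF integrand_expansion \<open>0 < c\<close>]
  have "\<forall>\<^sub>F \<epsilon> in at 0. AE x in M. \<forall>t\<in>{0..1}. \<bar>segment t (r \<epsilon>) (s \<epsilon>) x * f (r \<epsilon> x / segment t (r \<epsilon>) (s \<epsilon>) x) / p x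
      - main_terms \<epsilon> t x\<bar> \<le> c * \<bar>\<epsilon>\<bar> ^ 3"
    by (simp add: eventually_aefilter power_abs)
  with densities show ?thesis
  proof eventually_elim
    case (elim \<epsilon>)
    show ?case
    proof
      fix t :: real assume t: "t \<in> {0..1}"
      let ?h = "\<lambda>x. segment t (r \<epsilon>) (s \<epsilon>) x * f (r \<epsilon> x / segment t (r \<epsilon>) (s \<epsilon>) x)"
      note [measurable] = f_div_integrand_measurable[OF elim(1,2) t]
      define R where "R = (\<lambda>x. ?h x / p x - main_terms \<epsilon> t x)"
      have [measurable]: "R \<in> borel_measurable M" unfolding R_def by measurable
      have bd: "AE x in M. \<bar>R x\<bar> \<le> c * \<bar>\<epsilon>\<bar> ^ 3"
        using elim(3) unfolding R_def by eventually_elim (use t in blast)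
      have h: "?h x = R x * p x + main_terms \<epsilon> t x * p x" if "x \<in> space M" for x
        using p_pos[OF that] by (simp add: R_def field_simps)
      have int: "integrable M (\<lambda>x. R x * p x)"
        by (rule p_mult_integrable[OF _ bd]) measurable
      have inth: "integrable M ?h"
        using Bochner_Integration.integrable_add[OF int integral_main_terms(1)]
        by (subst Bochner_Integration.integrable_cong[OF refl h])
      have "f_div M f (r \<epsilon>) (segment t (r \<epsilon>) (s \<epsilon>)) = (LINT x|M. R x * p x + main_terms \<epsilon> t x * p x)"
        unfolding f_div_def by (rule Bochner_Integration.integral_cong[OF refl h])
      then have "f_div M f (r \<epsilon>) (segment t (r \<epsilon>) (s \<epsilon>)) - (LINT x|M. main_terms \<epsilon> t x * p x) = (LINT x|M. R x * p x)"
        using Bochner_Integration.integral_add[OF int integral_main_terms(1)] by simp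
      also have "\<bar>\<dots>\<bar> \<le> (LINT x|M. \<bar>R x * p x\<bar>)"
        by (rule integral_abs_bound)
      also have "\<dots> \<le> (LINT x|M. c * \<bar>\<epsilon>\<bar> ^ 3 * p x)"
      proof (rule integral_mono_AE)
        show "AE x in M. \<bar>R x * p x\<bar> \<le> c * \<bar>\<epsilon>\<bar> ^ 3 * p x"
          using bd AE_space[of M]
        proof eventually_elim
          case (elim x)
          have "\<bar>R x * p x\<bar> = \<bar>R x\<bar> * p x" using p_pos[OF elim(2)] by (simp add: abs_mult)
          with elim p_pos[OF elim(2)] show ?case by (simp add: mult_right_mono)
        qed
      qed (intro integrable_abs int integrable_mult_right p_integrable)+
      also have "\<dots> = c * \<bar>\<epsilon>\<bar> ^ 3" using p_integral by simp
      finally show "integrable M ?h \<and> \<bar>f_div M f (r \<epsilon>) (segment t (r \<epsilon>) (s \<epsilon>)) -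
          (\<epsilon>\<^sup>2 * (A2 * t\<^sup>2 * J) + \<epsilon> ^ 3 * (A2 * t\<^sup>2 * (K - I) - (A2 + A3) * t ^ 3 * L3))\<bar> \<le> c * \<bar>\<epsilon>\<bar> ^ 3"
        unfolding integral_main_terms(2) using inth by simp
    qed
  qed
qed

section \<open>Convexity and strict monotonicity of the divergence in t\<close>

lemma f_div_eventually_convex:
  "\<forall>\<^sub>F \<epsilon> in at 0. convex_on {0..1} (\<lambda>t. f_div M f (r \<epsilon>) (segment t (r \<epsilon>) (s \<epsilon>))) \<and>
     f_div M f (r \<epsilon>) (segment 0 (r \<epsilon>) (s \<epsilon>)) = 0"
  using f_div_uniform_expansion[OF zero_less_one] endpoint_AE_pos[OF r_expansion bounded(1,3)]
    endpoint_AE_pos[OF s_expansion bounded(2,4)]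
proof eventually_elim
  case (elim \<epsilon>)
  show ?case
  proof
    show "convex_on {0..1} (\<lambda>t. f_div M f (r \<epsilon>) (segment t (r \<epsilon>) (s \<epsilon>)))"
      by (rule f_div_segment_convex[OF f_convex elim(2,3)]) (use elim(1) in blast)
    show "f_div M f (r \<epsilon>) (segment 0 (r \<epsilon>) (s \<epsilon>)) = 0"
      by (rule f_div_segment_0[of f, OF f_1 elim(2)])
  qed
qed

text \<open>The expansion is needed at the single point \<open>d\<close>, to make the divergence
  positive there; convexity does the rest.\<close>

lemma f_div_eventually_strict_mono:
  assumes "0 < A2" "0 < J" "0 < d" "d \<le> 1"
  shows "\<forall>\<^sub>F \<epsilon> in at 0. strict_mono_on {d..1} (\<lambda>t. f_div M f (r \<epsilon>) (segment t (r \<epsilon>) (s \<epsilon>)))"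
proof -
  let ?D = "\<lambda>\<epsilon> t. f_div M f (r \<epsilon>) (segment t (r \<epsilon>) (s \<epsilon>))"
  have "\<forall>\<^sub>F \<epsilon> in at 0. 0 < ?D \<epsilon> d"
  proof (rule eventually_pos_leading_order)
    show "\<forall>\<^sub>F \<epsilon> in at 0. \<bar>?D \<epsilon> d - (\<epsilon>\<^sup>2 * (A2 * d\<^sup>2 * J) + \<epsilon> ^ 3 *
        (A2 * d\<^sup>2 * (K - I) - (A2 + A3) * d ^ 3 * L3))\<bar> \<le> \<bar>\<epsilon>\<bar> ^ 3"
      using f_div_uniform_expansion[OF zero_less_one] by eventually_elim (use assms in auto)
  qed (use assms in simp)
  with f_div_eventually_convex show ?thesis
    by eventually_elim (use assms in \<open>intro convex_on_strict_mono_beyond_positive, auto\<close>)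
qed

section \<open>The balancing equation\<close>

text \<open>Together with \<open>segment_flip\<close> this gives the expansion and monotonicity of
  the divergence from \<open>s\<close> without a second proof.\<close>

lemma swap: "perturbed_densities M p hB hA BB BA s r f A2 A3"
  by (intro perturbed_densities.intro p_density p_pos densities bounded r_expansion s_expansion f_convex f_1 taylor)

interpretation swap: perturbed_densities M p hB hA BB BA s r f A2 A3
  by (rule swap)

text \<open>The exchange negates \<open>\<Delta>\<close> and \<open>\<Delta>\<^sub>2\<close>, so
  even products stay and the cube changes sign; \<open>I\<close> gains \<open>L3\<close> because
  \<open>uB = uA + \<Delta>\<close>.\<close>

lemma swap_constants:
  "J_const M p uB uA = J" "L3_const M p uB uA = - L3" "swap.K = K" "swap.I = I + L3"
proof -
  show "J_const M p uB uA = J" by (simp add: J_const_def power2_commute)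
  have "(u - v) ^ 3 * q = - ((v - u) ^ 3 * q)" for u v q :: real
    by (simp add: power3_eq_cube algebra_simps)
  from this[of "uA _" "uB _" "p _"] show "L3_const M p uB uA = - L3" by (simp add: L3_const_def)
  show "swap.K = K"
    unfolding swap.K_def K_def by (rule Bochner_Integration.integral_cong) (auto simp: algebra_simps)
  have "((u - v)\<^sup>2 * v) * q = ((v - u)^2 * u) * q + (v - u)^3 * q" for u v q :: real
    by (simp add: power3_eq_cube power2_eq_square algebra_simps)
  from this[of "uA _" "uB _" "p _"] show "swap.I = I + L3"
    unfolding swap.I_def I_def L3_const_def using coefficients_integrable by simp
qed

lemma balance_expansion:
  fixes a b :: real
  assumes "0 < a" "0 < b" "0 < c"
  shows "\<forall>\<^sub>F \<epsilon> in at 0. \<forall>t\<in>{0..1}.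
     \<bar>a * f_div M f (r \<epsilon>) (segment t (r \<epsilon>) (s \<epsilon>)) - b * f_div M f (s \<epsilon>) (segment t (r \<epsilon>) (s \<epsilon>)) -
      (\<epsilon>\<^sup>2 * (A2 * J * (a * t\<^sup>2 - b * (1 - t)\<^sup>2)) + \<epsilon> ^ 3 *
        (a * (A2 * t\<^sup>2 * (K - I) - (A2 + A3) * t ^ 3 * L3) -
         b * (A2 * (1 - t)\<^sup>2 * (K - I - L3) + (A2 + A3) * (1 - t) ^ 3 * L3)))\<bar> \<le> c * \<bar>\<epsilon>\<bar> ^ 3"
proof -
  \<comment> \<open>After weighting by \<open>a\<close> and \<open>b\<close>, each of the two errors
    takes half of the allowance \<open>c\<close>.\<close>
  have "0 < c / (2 * a)" "0 < c / (2 * b)" using assms by auto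
  from f_div_uniform_expansion[OF this(1)] swap.f_div_uniform_expansion[OF this(2)]
  show ?thesis
  proof eventually_elim
    case (elim \<epsilon>)
    show ?case
    proof
      fix t :: real assume t: "t \<in> {0..1}"
      then have t': "1 - t \<in> {0..1}" by auto
      define D1 where "D1 = f_div M f (r \<epsilon>) (segment t (r \<epsilon>) (s \<epsilon>)) -
          (\<epsilon>\<^sup>2 * (A2 * t\<^sup>2 * J) + \<epsilon> ^ 3 * (A2 * t\<^sup>2 * (K - I) - (A2 + A3) * t ^ 3 * L3))"
      define D2 where "D2 = f_div M f (s \<epsilon>) (segment t (r \<epsilon>) (s \<epsilon>)) -
          (\<epsilon>\<^sup>2 * (A2 * (1 - t)\<^sup>2 * J) + \<epsilon> ^ 3 * (A2 * (1 - t)\<^sup>2 * (K - (I + L3)) - (A2 + A3) * (1 - t) ^ 3 * (- L3)))"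
      have "\<bar>D1\<bar> \<le> c / (2 * a) * \<bar>\<epsilon>\<bar> ^ 3" unfolding D1_def using elim(1) t by blast
      then have "\<bar>a * D1\<bar> \<le> c * \<bar>\<epsilon>\<bar> ^ 3 / 2" using assms by (simp add: abs_mult field_simps)
      moreover have "\<bar>D2\<bar> \<le> c / (2 * b) * \<bar>\<epsilon>\<bar> ^ 3"
        using bspec[OF elim(2) t'] unfolding D2_def swap_constants segment_flip[of t] by blast
      then have "\<bar>b * D2\<bar> \<le> c * \<bar>\<epsilon>\<bar> ^ 3 / 2" using assms by (simp add: abs_mult field_simps)
      ultimately have "\<bar>a * D1 - b * D2\<bar> \<le> c * \<bar>\<epsilon>\<bar> ^ 3" by linarith
      also have "a * D1 - b * D2 = a * f_div M f (r \<epsilon>) (segment t (r \<epsilon>) (s \<epsilon>)) - b * f_div M f (s \<epsilon>) (segment t (r \<epsilon>) (s \<epsilon>)) -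
      (\<epsilon>\<^sup>2 * (A2 * J * (a * t\<^sup>2 - b * (1 - t)\<^sup>2)) + \<epsilon> ^ 3 *
        (a * (A2 * t\<^sup>2 * (K - I) - (A2 + A3) * t ^ 3 * L3) -
         b * (A2 * (1 - t)\<^sup>2 * (K - I - L3) + (A2 + A3) * (1 - t) ^ 3 * L3)))"
        unfolding D1_def D2_def by (simp add: algebra_simps)
      finally show "\<bar>a * f_div M f (r \<epsilon>) (segment t (r \<epsilon>) (s \<epsilon>)) - b * f_div M f (s \<epsilon>) (segment t (r \<epsilon>) (s \<epsilon>)) -
      (\<epsilon>\<^sup>2 * (A2 * J * (a * t\<^sup>2 - b * (1 - t)\<^sup>2)) + \<epsilon> ^ 3 *
        (a * (A2 * t\<^sup>2 * (K - I) - (A2 + A3) * t ^ 3 * L3) -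
         b * (A2 * (1 - t)\<^sup>2 * (K - I - L3) + (A2 + A3) * (1 - t) ^ 3 * L3)))\<bar> \<le> c * \<bar>\<epsilon>\<bar> ^ 3" .
    qed
  qed
qed

text \<open>Convex functions are continuous on the open interval; the second divergence is convex in
  \<open>1 - t\<close>.\<close>

lemma balance_continuous:
  fixes a b :: real
  shows "\<forall>\<^sub>F \<epsilon> in at 0. continuous_on {0<..<1} (\<lambda>t.
    a * f_div M f (r \<epsilon>) (segment t (r \<epsilon>) (s \<epsilon>)) - b * f_div M f (s \<epsilon>) (segment t (r \<epsilon>) (s \<epsilon>)))"
  using f_div_eventually_convex swap.f_div_eventually_convex
proof eventually_elim
  case (elim \<epsilon>)
  have 1: "continuous_on {0<..<1} g" if "convex_on {0..1} g" for g :: "real \<Rightarrow> real"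
    by (rule convex_on_continuous) (auto intro!: convex_on_subset[OF that])
  have 2: "continuous_on {0<..<1::real} (\<lambda>t. f_div M f (s \<epsilon>) (segment (1 - t) (s \<epsilon>) (r \<epsilon>)))"
    by (rule continuous_on_compose2[OF 1[OF elim(2)[THEN conjunct1]]]) (auto intro!: continuous_intros)
  show ?case
    unfolding segment_flip[of _ "r \<epsilon>" "s \<epsilon>"]
    by (intro continuous_intros 2) (use 1[OF elim(1)[THEN conjunct1]] in \<open>simp flip: segment_flip\<close>)
qed

text \<open>The divergence from \<open>r\<close> increases on \<open>{d..1}\<close>, the one from
  \<open>s\<close> decreases on \<open>{0..1 - d}\<close>, and \<open>{d..1 - d}\<close> is the
  overlap.\<close>

lemma balance_strict_mono:
  fixes a b :: real
  assumes ab: "0 < a" "0 < b" and A2: "0 < A2" and J: "0 < J" and d: "0 < d" "d \<le> 1"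
  shows "\<forall>\<^sub>F \<epsilon> in at 0. strict_mono_on {d..1 - d} (\<lambda>t.
    a * f_div M f (r \<epsilon>) (segment t (r \<epsilon>) (s \<epsilon>)) - b * f_div M f (s \<epsilon>) (segment t (r \<epsilon>) (s \<epsilon>)))"
  using f_div_eventually_strict_mono[OF A2 J d]
    swap.f_div_eventually_strict_mono[unfolded swap_constants, OF A2 J d]
proof eventually_elim
  case (elim \<epsilon>)
  show ?case
  proof (rule strict_mono_onI)
    fix x y assume xy: "x \<in> {d..1 - d}" "y \<in> {d..1 - d}" "x < y"
    have "f_div M f (r \<epsilon>) (segment x (r \<epsilon>) (s \<epsilon>)) < f_div M f (r \<epsilon>) (segment y (r \<epsilon>) (s \<epsilon>))"
      using strict_mono_onD[OF elim(1)] xy d by auto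
    moreover have "f_div M f (s \<epsilon>) (segment (1 - y) (s \<epsilon>) (r \<epsilon>)) < f_div M f (s \<epsilon>) (segment (1 - x) (s \<epsilon>) (r \<epsilon>))"
      using strict_mono_onD[OF elim(2), of "1 - y" "1 - x"] xy d by auto
    ultimately show "a * f_div M f (r \<epsilon>) (segment x (r \<epsilon>) (s \<epsilon>)) - b * f_div M f (s \<epsilon>) (segment x (r \<epsilon>) (s \<epsilon>))
        < a * f_div M f (r \<epsilon>) (segment y (r \<epsilon>) (s \<epsilon>)) - b * f_div M f (s \<epsilon>) (segment y (r \<epsilon>) (s \<epsilon>))"
      using ab unfolding segment_flip[of _ "s \<epsilon>" "r \<epsilon>"] by (simp add: diff_strict_mono)
  qed
qed

end

text \<open>\<open>local_balancing_root\<close> determines \<open>T\<close> only for small nonzero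
  \<epsilon>. Existence is therefore asserted separately, and the expansions hold for every function
  representing the branch.\<close>

theorem theorem5:
  fixes M :: "'a measure"
    and p hA hB BA BB uA uB :: "'a \<Rightarrow> real"
    and r s :: "real \<Rightarrow> 'a \<Rightarrow> real"
    and f :: "real \<Rightarrow> real"
    and a b t0 \<tau> :: real
  assumes p_density: "prob_density M p"
    and p_pos: "\<forall>x\<in>space M. 0 < p x"
    and r_density: "\<forall>\<^sub>F \<epsilon> in at 0. prob_density M (r \<epsilon>)"
    and s_density: "\<forall>\<^sub>F \<epsilon> in at 0. prob_density M (s \<epsilon>)"
    and bounded: "rel_bounded M p hA" "rel_bounded M p hB" "rel_bounded M p BA" "rel_bounded M p BB"
    and mean_zero: "(LINT x|M. hA x) = 0" "(LINT x|M. hB x) = 0"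
      "(LINT x|M. BA x) = 0" "(LINT x|M. BB x) = 0"
    and r_expansion: "second_order_expansion M p r hA BA"
    and s_expansion: "second_order_expansion M p s hB BB"
    and uA: "uA = (\<lambda>x. hA x / p x)"
    and uB: "uB = (\<lambda>x. hB x / p x)"
    and J_pos: "J_const M p uA uB > 0"
    and f_convex: "convex_on {0<..} f"
    and f_C3: "\<exists>U. open U \<and> 1 \<in> U \<and> Ck_on 3 f U"
    and f_at_1: "f 1 = 0" "deriv f 1 = 0" "(deriv ^^ 2) f 1 > 0"
    and weights: "a > 0" "b > 0"
    and t0: "t0 = t_zero a b"
    and \<tau>: "\<tau> = root_slope M p f a b uA uB"
  shows "(\<exists>T. local_balancing_root M f a b r s T) \<and>
    (\<forall>T. local_balancing_root M f a b r s T \<longrightarrow>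
      (\<lambda>\<epsilon>. T \<epsilon> - (t0 + \<epsilon> * \<tau>)) \<in> o[at 0](\<lambda>\<epsilon>. \<epsilon>) \<and>
      second_order_expansion M p (\<lambda>\<epsilon>. segment (T \<epsilon>) (r \<epsilon>) (s \<epsilon>))
        (\<lambda>x. (1 - t0) * hA x + t0 * hB x)
        (\<lambda>x. (1 - t0) * BA x + t0 * BB x + \<tau> * (hB x - hA x)))"
proof -
  define A2 A3 J L3 where "A2 = A2_const f" and "A3 = A3_const f"
    and "J = J_const M p uA uB" and "L3 = L3_const M p uA uB"
  from f_C3 obtain U where "open U" "1 \<in> U" "Ck_on 3 f U" by blast
  from cubic_taylor_remainder[OF this f_at_1(1,2)]
  have taylor: "(\<lambda>y. f (1 + y) - (A2 * y^2 + A3 * y^3)) \<in> o[nhds 0](\<lambda>y. y^3)"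
    by (simp add: A2_def A3_def)
  interpret perturbed_densities M p hA hB BA BB r s f A2 A3
    by (intro perturbed_densities.intro p_density p_pos[rule_format] r_density s_density bounded
        r_expansion s_expansion f_convex f_at_1(1) taylor)
  have A2_pos: "0 < A2" using f_at_1(3) by (simp add: A2_def A2_const_def)
  have J_pos': "0 < J" using J_pos by (simp add: J_def)
  define G where "G = (\<lambda>\<epsilon> t. a * f_div M f (r \<epsilon>) (segment t (r \<epsilon>) (s \<epsilon>)) - b * f_div M f (s \<epsilon>) (segment t (r \<epsilon>) (s \<epsilon>)))"
  have balancing_iff: "balancing M f a b (r \<epsilon>) (s \<epsilon>) t \<longleftrightarrow> G \<epsilon> t = 0" for \<epsilon> t
    by (simp add: balancing_def G_def)
  define E where "E = (\<lambda>t. a * (A2 * t\<^sup>2 * (K - I) - (A2 + A3) * t ^ 3 * L3) -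
         b * (A2 * (1 - t)\<^sup>2 * (K - I - L3) + (A2 + A3) * (1 - t) ^ 3 * L3))"
  have expansion: "\<forall>\<^sub>F \<epsilon> in at 0. \<forall>t\<in>{0..1}.
      \<bar>G \<epsilon> t - (\<epsilon>\<^sup>2 * (A2 * J * (a * t\<^sup>2 - b * (1 - t)\<^sup>2)) + \<epsilon> ^ 3 * E t)\<bar> \<le> c * \<bar>\<epsilon>\<bar> ^ 3"
    if "0 < c" for c
    using balance_expansion[OF weights that] unfolding G_def E_def J_def L3_def uA uB .
  have c0: "0 < A2 * J" using A2_pos J_pos' by simp
  have "\<exists>T. local_balancing_root M f a b r s T"
  proof (rule root_near_leading_root[OF weights c0])
    show "\<forall>\<^sub>F \<epsilon> in at 0. \<forall>t\<in>{0..1}.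
      \<bar>G \<epsilon> t - (\<epsilon>\<^sup>2 * (A2 * J * (a * t\<^sup>2 - b * (1 - t)\<^sup>2)) + \<epsilon> ^ 3 * E t)\<bar> \<le> \<bar>\<epsilon>\<bar> ^ 3"
      using expansion[OF zero_less_one] by simp
    show "\<forall>\<^sub>F \<epsilon> in at 0. continuous_on {0<..<1} (G \<epsilon>)"
      unfolding G_def by (rule balance_continuous)
    show "\<forall>\<^sub>F \<epsilon> in at 0. strict_mono_on {d..1 - d} (G \<epsilon>)" if "0 < d" "d \<le> 1" for d
      unfolding G_def using J_pos' weights that A2_pos unfolding J_def uA uB by (intro balance_strict_mono)
    show ?thesis if "(T \<longlongrightarrow> t_zero a b) (at 0)" "0 < \<delta>"
      "\<forall>\<^sub>F \<epsilon> in at 0. {t \<in> {0..1}. \<bar>t - t_zero a b\<bar> < \<delta> \<and> G \<epsilon> t = 0} = {T \<epsilon>}" for T \<delta>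
      using that unfolding local_balancing_root_def balancing_iff by blast
  qed
  \<comment> \<open>At \<open>t0\<close> the terms with \<open>K - I\<close> cancel, and the
    \<open>A2 * L3\<close> left by the exchange of endpoints cancels the \<open>A2\<close> part of
    \<open>A2 + A3\<close>; only \<open>A3\<close> survives.\<close>
  moreover have slope: "- E t0 / (2 * (A2 * J) * (sqrt a * sqrt b)) = \<tau>"
  proof -
    define S where "S = sqrt a + sqrt b"
    have S: "0 < S" "sqrt a > 0" "sqrt b > 0" using weights by (auto simp: S_def intro: add_pos_pos)
    have t0S: "t0 = sqrt b / S" by (simp add: t0 t_zero_def S_def)
    have t1S: "1 - t0 = sqrt a / S" unfolding t0S using S(1) by (simp add: S_def field_simps)
    have a2: "a = (sqrt a)\<^sup>2" and b2: "b = (sqrt b)\<^sup>2" using weights by auto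
    \<comment> \<open>The common value of \<open>a * t0^2\<close> and \<open>b * (1 - t0)^2\<close>;
      as \<open>t0\<close> and \<open>1 - t0\<close> sum to 1, it is also the value of the cubic
      expression in the numerator of the slope.\<close>
    define c where "c = a * b / S\<^sup>2"
    have ca: "a * t0\<^sup>2 = c" unfolding t0S c_def by (simp add: power_divide b2[symmetric])
    have cb: "b * (1 - t0)\<^sup>2 = c" unfolding t1S c_def by (simp add: power_divide a2[symmetric])
    \<comment> \<open>Identifies the geometric mean, which comes from the cofactor at
      \<open>t0\<close>, with the weighted sum in the denominator of
      \<open>root_slope\<close>.\<close>
    have den: "a * t0 + b * (1 - t0) = sqrt a * sqrt b"
    proof -
      have "a * t0 + b * (1 - t0) = (a * sqrt b + b * sqrt a) / S"
        unfolding t1S unfolding t0S by (simp add: add_divide_distrib)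
      also have "a * sqrt b + b * sqrt a = sqrt a * sqrt b * S"
        using a2 b2 unfolding S_def by algebra
      finally show ?thesis using S by simp
    qed
    have num: "a * t0 ^ 3 + b * (1 - t0) ^ 3 = c"
    proof -
      have "a * t0 ^ 3 + b * (1 - t0) ^ 3 = (a * t0\<^sup>2) * t0 + (b * (1 - t0)\<^sup>2) * (1 - t0)"
        by (simp add: power2_eq_square power3_eq_cube)
      then show ?thesis unfolding ca cb by (simp add: algebra_simps)
    qed
    have "E t0 = A2 * (a * t0\<^sup>2) * (K - I) - A2 * (b * (1 - t0)\<^sup>2) * (K - I - L3)
        - (A2 + A3) * L3 * (a * t0 ^ 3 + b * (1 - t0) ^ 3)"
      unfolding E_def by (simp add: algebra_simps)
    also have "\<dots> = - (A3 * L3 * c)" unfolding ca cb num by (simp add: algebra_simps)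
    finally have "E t0 = - (A3 * L3 * c)" .
    then show ?thesis
      unfolding \<tau> root_slope_def t0[symmetric] num den by (simp add: A2_def A3_def J_def L3_def mult_ac)
  qed
  moreover have "(\<lambda>\<epsilon>. T \<epsilon> - (t0 + \<epsilon> * \<tau>)) \<in> o[at 0](\<lambda>\<epsilon>. \<epsilon>) \<and>
      second_order_expansion M p (\<lambda>\<epsilon>. segment (T \<epsilon>) (r \<epsilon>) (s \<epsilon>))
        (\<lambda>x. (1 - t0) * hA x + t0 * hB x)
        (\<lambda>x. (1 - t0) * BA x + t0 * BB x + \<tau> * (hB x - hA x))"
    if T: "local_balancing_root M f a b r s T" for T
  proof -
    from T have lim: "(T \<longlongrightarrow> t0) (at 0)" by (simp add: local_balancing_root_def t0)
    from T obtain \<delta> where "\<forall>\<^sub>F \<epsilon> in at 0. {t \<in> {0..1}. \<bar>t - t0\<bar> < \<delta> \<and> G \<epsilon> t = 0} = {T \<epsilon>}"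
      unfolding local_balancing_root_def balancing_iff t0 by blast
    then have root: "\<forall>\<^sub>F \<epsilon> in at 0. T \<epsilon> \<in> {0..1} \<and> G \<epsilon> (T \<epsilon>) = 0"
      by eventually_elim blast
    have "isCont E t0" unfolding E_def by (intro continuous_intros)
    from balancing_root_slope[OF weights c0 expansion lim[unfolded t0] root this[unfolded t0]]
    have o: "(\<lambda>\<epsilon>. T \<epsilon> - (t0 + \<epsilon> * \<tau>)) \<in> o[at 0](\<lambda>\<epsilon>. \<epsilon>)"
      unfolding slope[symmetric] t0 .
    with segment_expansion[OF lim o] show ?thesis by blast
  qed
  ultimately show ?thesis by blast
qed

end
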